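(* The action of $\mathrm{GL}_{n-1}$ on each adjoint orbit $\mathrm{GL}_n x\subset\mathfrak{gl}_n$ is coisotropic.
   Context: $\Bbbk$ is an algebraically closed field of characteristic $0$; $\mathrm{GL}_n=\mathrm{GL}_n(\Bbbk)$, $\mathfrak{gl}_n=\mathfrak{gl}_n(\Bbbk)\simeq\mathfrak{gl}_n^*$ via the trace form, and $\mathrm{GL}_{n-1}\subset\mathrm{GL}_n$ is the standard subgroup with Lie algebra $\mathfrak{gl}_{n-1}=\langle E_{ij}\mid i,j>1\rangle_{\Bbbk}$. Each (co)adjoint orbit $M=\mathrm{GL}_nx$ is a smooth symplectic variety with the Kirillov--Kostant--Souriau form $\omega$, given (up to sign) by $\omega_\gamma(\xi\cdot\gamma,\eta\cdot\gamma)=\gamma([\xi,\eta])$ for $\gamma\in M$ and $\xi,\eta\in\mathfrak{gl}_n$. The action of a subgroup $Q$ with Lie algebra $\mathfrak q$ on $M$ is Hamiltonian, and it is called coisotropic if $(\mathfrak q y)^\perp\subset\mathfrak q y$ for generic $y\in M$, where $\mathfrak q y=T_y(Qy)$ and the orthogonal complement in $T_yM$ is taken with respect to $\omega_y$. *)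

theory Defs
  imports "Jordan_Normal_Form.Char_Poly"
begin

text \<open>
  Matrices are those of the entry Jordan_Normal_Form: \<open>carrier_mat n n\<close> plays the role of
  \<open>gl\<^sub>n\<close>, with rows and columns indexed by \<open>0, \<dots>, n - 1\<close>, so that the first row and column
  have index \<open>0\<close>.
\<close>

definition GL :: "nat \<Rightarrow> 'k::field mat set" where
  "GL n = {g \<in> carrier_mat n n. invertible_mat g}"

text \<open>The standard subgroup \<open>GL\<^sub>n\<^sub>-\<^sub>1\<close> of \<open>GL\<^sub>n\<close>: block diagonal matrices \<open>diag(1, h)\<close>.\<close>

definition GL_sub :: "nat \<Rightarrow> 'k::field mat set" where
  "GL_sub n =
     {four_block_mat (1\<^sub>m 1) (0\<^sub>m 1 (n - 1)) (0\<^sub>m (n - 1) 1) h | h. h \<in> GL (n - 1)}"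

definition adjoint_orbit :: "nat \<Rightarrow> 'k::field mat \<Rightarrow> 'k mat set" where
  "adjoint_orbit n x =
     {g * x * h | g h. g \<in> GL n \<and> h \<in> carrier_mat n n \<and> inverts_mat g h \<and> inverts_mat h g}"

definition bracket :: "'k::field mat \<Rightarrow> 'k mat \<Rightarrow> 'k mat" where
  "bracket a b = a * b - b * a"

definition mat_trace :: "'k::field mat \<Rightarrow> 'k" where
  "mat_trace a = (\<Sum>i<dim_row a. a $$ (i, i))"


subsection \<open>Zariski topology on \<open>gl\<^sub>n\<close>\<close>

inductive_set poly_funs :: "nat \<Rightarrow> ('k::field mat \<Rightarrow> 'k) set" for n :: nat where
  const: "(\<lambda>_. c) \<in> poly_funs n"
| coord: "i < n \<Longrightarrow> j < n \<Longrightarrow> (\<lambda>a. a $$ (i, j)) \<in> poly_funs n"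
| add: "f \<in> poly_funs n \<Longrightarrow> g \<in> poly_funs n \<Longrightarrow> (\<lambda>a. f a + g a) \<in> poly_funs n"
| mult: "f \<in> poly_funs n \<Longrightarrow> g \<in> poly_funs n \<Longrightarrow> (\<lambda>a. f a * g a) \<in> poly_funs n"

definition zariski_closed :: "nat \<Rightarrow> 'k::field mat set \<Rightarrow> bool" where
  "zariski_closed n Z \<longleftrightarrow>
     (\<exists>F \<subseteq> poly_funs n. Z = {a \<in> carrier_mat n n. \<forall>f\<in>F. f a = 0})"

text \<open>Openness in the subspace topology of \<open>M \<subseteq> gl\<^sub>n\<close>.\<close>

definition zariski_open_in :: "nat \<Rightarrow> 'k::field mat set \<Rightarrow> 'k mat set \<Rightarrow> bool" where
  "zariski_open_in n M U \<longleftrightarrow> (\<exists>Z. zariski_closed n Z \<and> U = M - Z)"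


subsection \<open>Lie algebras of matrix groups\<close>

text \<open>
  The Lie algebra of \<open>Q \<subseteq> GL\<^sub>n\<close> is the Zariski tangent space of \<open>Q\<close> at the identity: the
  directions \<open>\<xi>\<close> along which the derivative at \<open>1\<close> of every polynomial function vanishing on
  \<open>Q\<close> is zero. The function \<open>t \<mapsto> f (1 + t \<xi>)\<close> is polynomial in \<open>t\<close>, and the polynomial \<open>p\<close>
  representing it is unique over an infinite field.
\<close>

definition lie_algebra :: "nat \<Rightarrow> 'k::field_char_0 mat set \<Rightarrow> 'k mat set" where
  "lie_algebra n Q = {\<xi> \<in> carrier_mat n n. \<forall>f \<in> poly_funs n. (\<forall>g\<in>Q. f g = 0) \<longrightarrow>
     (\<exists>p. (\<forall>t. f (1\<^sub>m n + t \<cdot>\<^sub>m \<xi>) = poly p t) \<and> poly (pderiv p) 0 = 0)}"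

text \<open>
  The action being conjugation, \<open>\<xi>\<close> acts at the point \<open>y\<close> by the tangent vector \<open>[\<xi>, y]\<close>;
  this gives \<open>q y = T\<^sub>y(Q y)\<close> for \<open>q = Lie(Q)\<close>, and \<open>T\<^sub>y M\<close> for \<open>q = gl\<^sub>n\<close>.
\<close>

definition inf_orbit :: "'k::field mat set \<Rightarrow> 'k mat \<Rightarrow> 'k mat set" where
  "inf_orbit q y = (\<lambda>\<xi>. bracket \<xi> y) ` q"


subsection \<open>The Kirillov--Kostant--Souriau form and coisotropic actions\<close>

text \<open>
  Under the trace form \<open>y\<close> is the functional \<open>\<zeta> \<mapsto> tr(y \<zeta>)\<close>. The lemma \<open>kks_bracket\<close> below
  shows that the value does not depend on the choice of \<open>\<xi>\<close> and \<open>\<eta>\<close>.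
\<close>

definition kks :: "nat \<Rightarrow> 'k::field mat \<Rightarrow> 'k mat \<Rightarrow> 'k mat \<Rightarrow> 'k" where
  "kks n y u v = (THE c. \<exists>\<xi> \<in> carrier_mat n n. \<exists>\<eta> \<in> carrier_mat n n.
     u = bracket \<xi> y \<and> v = bracket \<eta> y \<and> c = mat_trace (y * bracket \<xi> \<eta>))"

definition kks_perp :: "nat \<Rightarrow> 'k::field mat \<Rightarrow> 'k mat set \<Rightarrow> 'k mat set" where
  "kks_perp n y W = {u \<in> inf_orbit (carrier_mat n n) y. \<forall>w\<in>W. kks n y u w = 0}"

text \<open>
  Generic means: on some nonempty Zariski open subset of the orbit. As \<open>GL\<^sub>n\<close> is irreducible,
  so is the orbit, and such a subset is dense.
\<close>

definition coisotropic_action :: "nat \<Rightarrow> 'k::field_char_0 mat set \<Rightarrow> 'k mat \<Rightarrow> bool" where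
  "coisotropic_action n Q x \<longleftrightarrow>
     (\<exists>U. zariski_open_in n (adjoint_orbit n x) U \<and> U \<noteq> {} \<and>
       (\<forall>y\<in>U. kks_perp n y (inf_orbit (lie_algebra n Q) y) \<subseteq> inf_orbit (lie_algebra n Q) y))"


subsection \<open>Consistency of the definitions\<close>

lemma mat_trace_comm:
  assumes "a \<in> carrier_mat n m" "b \<in> carrier_mat m n"
  shows "mat_trace (a * b) = mat_trace (b * a)"
proof -
  have "mat_trace (a * b) = (\<Sum>i<n. \<Sum>j<m. a $$ (i,j) * b $$ (j,i))"
    using assms by (auto simp: mat_trace_def scalar_prod_def lessThan_atLeast0 intro!: sum.cong)
  also have "\<dots> = (\<Sum>j<m. \<Sum>i<n. b $$ (j,i) * a $$ (i,j))"
    by (subst sum.swap) (simp add: mult.commute)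
  also have "\<dots> = mat_trace (b * a)"
    using assms by (auto simp: mat_trace_def scalar_prod_def lessThan_atLeast0 intro!: sum.cong)
  finally show ?thesis .
qed

lemma mat_trace_minus:
  assumes "a \<in> carrier_mat n n" "b \<in> carrier_mat n n"
  shows "mat_trace (a - b) = mat_trace a - mat_trace b"
  using assms by (auto simp: mat_trace_def sum_subtractf)

lemma mat_trace_bracket:
  fixes y :: "'k::field mat"
  assumes [simp]: "y \<in> carrier_mat n n" "\<xi> \<in> carrier_mat n n" "\<eta> \<in> carrier_mat n n"
  shows "mat_trace (y * bracket \<xi> \<eta>) = - mat_trace (bracket \<xi> y * \<eta>)"
    and "mat_trace (y * bracket \<xi> \<eta>) = mat_trace (\<xi> * bracket \<eta> y)"
proof -
  note [simp] = mult_carrier_mat[of _ n n]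
  have 1: "mat_trace (y * bracket \<xi> \<eta>) = mat_trace (y * (\<xi> * \<eta>)) - mat_trace (y * (\<eta> * \<xi>))"
    by (simp add: bracket_def mult_minus_distrib_mat[of _ n n _ n] mat_trace_minus[of _ n])
  have 2: "mat_trace (bracket \<xi> y * \<eta>) = mat_trace (\<xi> * y * \<eta>) - mat_trace (y * \<xi> * \<eta>)"
    by (simp add: bracket_def minus_mult_distrib_mat[of _ n n _ _ n] mat_trace_minus[of _ n])
  have 3: "mat_trace (\<xi> * bracket \<eta> y) = mat_trace (\<xi> * (\<eta> * y)) - mat_trace (\<xi> * (y * \<eta>))"
    by (simp add: bracket_def mult_minus_distrib_mat[of _ n n _ n] mat_trace_minus[of _ n])
  have a1: "y * (\<xi> * \<eta>) = y * \<xi> * \<eta>" by (simp add: assoc_mult_mat[of _ n n _ n _ n])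
  have a2: "\<xi> * (y * \<eta>) = \<xi> * y * \<eta>" by (simp add: assoc_mult_mat[of _ n n _ n _ n])
  have a3: "mat_trace (y * (\<eta> * \<xi>)) = mat_trace (\<xi> * y * \<eta>)"
    using mat_trace_comm[of "y * \<eta>" n n \<xi>] assoc_mult_mat[of y n n \<eta> n \<xi> n] a2 by simp
  have a4: "mat_trace (\<xi> * (\<eta> * y)) = mat_trace (y * \<xi> * \<eta>)"
    using mat_trace_comm[of "\<xi> * \<eta>" n n y] assoc_mult_mat[of \<xi> n n \<eta> n y n] a1 by simp
  show "mat_trace (y * bracket \<xi> \<eta>) = - mat_trace (bracket \<xi> y * \<eta>)"
    by (simp only: 1 2 a1 a3 minus_diff_eq)
  show "mat_trace (y * bracket \<xi> \<eta>) = mat_trace (\<xi> * bracket \<eta> y)"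
    by (simp only: 1 3 a1 a2 a3 a4)
qed

lemma kks_bracket:
  fixes y :: "'k::field mat"
  assumes "y \<in> carrier_mat n n" "\<xi> \<in> carrier_mat n n" "\<eta> \<in> carrier_mat n n"
  shows "kks n y (bracket \<xi> y) (bracket \<eta> y) = mat_trace (y * bracket \<xi> \<eta>)"
  unfolding kks_def
proof (rule the_equality)
  show "\<exists>\<xi>'\<in>carrier_mat n n. \<exists>\<eta>'\<in>carrier_mat n n. bracket \<xi> y = bracket \<xi>' y \<and>
      bracket \<eta> y = bracket \<eta>' y \<and> mat_trace (y * bracket \<xi> \<eta>) = mat_trace (y * bracket \<xi>' \<eta>')"
    using assms by blast
  fix c
  assume "\<exists>\<xi>'\<in>carrier_mat n n. \<exists>\<eta>'\<in>carrier_mat n n. bracket \<xi> y = bracket \<xi>' y \<and>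
      bracket \<eta> y = bracket \<eta>' y \<and> c = mat_trace (y * bracket \<xi>' \<eta>')"
  then obtain \<xi>' \<eta>' where *: "\<xi>' \<in> carrier_mat n n" "\<eta>' \<in> carrier_mat n n"
    "bracket \<xi> y = bracket \<xi>' y" "bracket \<eta> y = bracket \<eta>' y"
    "c = mat_trace (y * bracket \<xi>' \<eta>')" by blast
  have "c = - mat_trace (bracket \<xi> y * \<eta>')"
    using * assms mat_trace_bracket(1)[of y n \<xi>' \<eta>'] by simp
  also have "\<dots> = mat_trace (y * bracket \<xi> \<eta>')"
    using * assms mat_trace_bracket(1)[of y n \<xi> \<eta>'] by simp
  also have "\<dots> = mat_trace (y * bracket \<xi> \<eta>)"
    using * assms mat_trace_bracket(2)[of y n \<xi> \<eta>'] mat_trace_bracket(2)[of y n \<xi> \<eta>] by simp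
  finally show "c = mat_trace (y * bracket \<xi> \<eta>)" .
qed

lemma poly_funs_line:
  fixes f :: "'k::field mat \<Rightarrow> 'k"
  assumes "f \<in> poly_funs n" "a \<in> carrier_mat n n" "\<xi> \<in> carrier_mat n n"
  shows "\<exists>p. \<forall>t. f (a + t \<cdot>\<^sub>m \<xi>) = poly p t"
  using assms(1)
proof induction
  case (const c)
  show ?case by (rule exI[of _ "[:c:]"]) simp
next
  case (coord i j)
  then show ?case using assms(2,3)
    by (intro exI[of _ "[:a $$ (i,j), \<xi> $$ (i,j):]"]) auto
next
  case (add f g)
  then obtain p q where "\<forall>t. f (a + t \<cdot>\<^sub>m \<xi>) = poly p t" "\<forall>t. g (a + t \<cdot>\<^sub>m \<xi>) = poly q t"
    by blast
  then show ?case by (intro exI[of _ "p + q"]) simp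
next
  case (mult f g)
  then obtain p q where "\<forall>t. f (a + t \<cdot>\<^sub>m \<xi>) = poly p t" "\<forall>t. g (a + t \<cdot>\<^sub>m \<xi>) = poly q t"
    by blast
  then show ?case by (intro exI[of _ "p * q"]) simp
qed

lemma invertible_mat_iff_det:
  fixes a :: "'k::field mat"
  assumes "a \<in> carrier_mat n n"
  shows "invertible_mat a \<longleftrightarrow> det a \<noteq> 0"
proof
  assume "invertible_mat a"
  then obtain b where b: "a * b = 1\<^sub>m n" "b * a = 1\<^sub>m (dim_row b)"
    using assms by (auto simp: invertible_mat_def inverts_mat_def)
  have "dim_col (a * b) = n" using b by simp
  moreover have "dim_col (b * a) = dim_row b" by (subst b(2)) simp
  ultimately have "b \<in> carrier_mat n n" using assms by auto
  then have "det a * det b = 1" using b assms det_mult[of a n b] by simp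
  then show "det a \<noteq> 0" by auto
next
  assume "det a \<noteq> 0"
  from det_non_zero_imp_unit[OF assms this]
  obtain b where "b \<in> carrier_mat n n" "b * a = 1\<^sub>m n" "a * b = 1\<^sub>m n"
    by (auto simp: Units_def ring_mat_def)
  then show "invertible_mat a"
    using assms by (auto simp: invertible_mat_def inverts_mat_def square_mat.simps)
qed

lemma GL_sub_entries:
  assumes "1 \<le> n"
  shows "GL_sub n = {g \<in> carrier_mat n n. det g \<noteq> 0 \<and> g $$ (0,0) = 1 \<and>
           (\<forall>i. 0 < i \<longrightarrow> i < n \<longrightarrow> g $$ (0,i) = 0 \<and> g $$ (i,0) = (0::'k::field))}"
    (is "_ = ?R")
proof (intro equalityI subsetI)
  fix g :: "'k mat" assume "g \<in> GL_sub n"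
  then obtain h where h: "h \<in> GL (n-1)"
    "g = four_block_mat (1\<^sub>m 1) (0\<^sub>m 1 (n - 1)) (0\<^sub>m (n - 1) 1) h"
    by (auto simp: GL_sub_def)
  then have hc: "h \<in> carrier_mat (n-1) (n-1)" by (simp add: GL_def)
  have "det g = det (1\<^sub>m 1 :: 'k mat) * det h" unfolding h(2)
    by (rule det_four_block_mat_lower_left_zero) (use hc in auto)
  then have "det g \<noteq> 0" using h(1) hc by (simp add: GL_def invertible_mat_iff_det[OF hc])
  then show "g \<in> ?R" using hc h(2) assms by (auto simp: four_block_mat_def)
next
  fix g :: "'k mat" assume g: "g \<in> ?R"
  define h where "h = mat (n-1) (n-1) (\<lambda>(i,j). g $$ (Suc i, Suc j))"
  have hc: "h \<in> carrier_mat (n-1) (n-1)" by (simp add: h_def)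
  have ge: "g = four_block_mat (1\<^sub>m 1) (0\<^sub>m 1 (n - 1)) (0\<^sub>m (n - 1) 1) h"
    by (rule eq_matI) (use g hc assms in \<open>auto simp: h_def\<close>)
  have "det g = det (1\<^sub>m 1 :: 'k mat) * det h" unfolding ge
    by (rule det_four_block_mat_lower_left_zero) (use hc in auto)
  then have "h \<in> GL (n-1)" using g hc by (simp add: GL_def invertible_mat_iff_det[OF hc])
  then show "g \<in> GL_sub n" unfolding GL_sub_def using ge by blast
qed

lemma det_poly_fun:
  fixes a :: "'k::field mat"
  assumes "a \<in> carrier_mat n n" "\<xi> \<in> carrier_mat n n"
  shows "\<exists>p. \<forall>t. det (a + t \<cdot>\<^sub>m \<xi>) = poly p t"
proof -
  let ?p = "\<Sum>\<pi> | \<pi> permutes {0..<n}.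
    Polynomial.smult (signof \<pi>) (\<Prod>i = 0..<n. [:a $$ (i, \<pi> i), \<xi> $$ (i, \<pi> i):])"
  have "det (a + t \<cdot>\<^sub>m \<xi>) = poly ?p t" for t
  proof -
    have "det (a + t \<cdot>\<^sub>m \<xi>) =
        (\<Sum>\<pi> | \<pi> permutes {0..<n}. signof \<pi> * (\<Prod>i = 0..<n. (a + t \<cdot>\<^sub>m \<xi>) $$ (i, \<pi> i)))"
      by (rule det_def') (use assms in auto)
    also have "\<dots> = poly ?p t"
      unfolding poly_sum Polynomial.poly_smult poly_prod
      using assms by (intro sum.cong arg_cong2[of _ _ _ _ "(*)"] prod.cong)
        (auto simp: permutes_in_image)
    finally show ?thesis .
  qed
  then show ?thesis by blast
qed

text \<open>The Lie algebra of \<open>GL_sub n\<close> is the span of the \<open>E\<^sub>i\<^sub>j\<close> with \<open>i\<close>, \<open>j\<close> not the first index.\<close>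

lemma lie_algebra_GL_sub:
  assumes "1 \<le> n"
  shows "lie_algebra n (GL_sub n :: 'k::field_char_0 mat set) =
    {\<xi> \<in> carrier_mat n n. \<forall>i<n. \<xi> $$ (0,i) = 0 \<and> \<xi> $$ (i,0) = 0}" (is "_ = ?R")
proof (intro equalityI subsetI)
  fix \<xi> :: "'k mat" assume x: "\<xi> \<in> lie_algebra n (GL_sub n)"
  then have xc: "\<xi> \<in> carrier_mat n n" by (simp add: lie_algebra_def)
  have main: "\<xi> $$ (i,j) = 0"
    if ij: "i < n" "j < n" and c: "\<And>g :: 'k mat. g \<in> GL_sub n \<Longrightarrow> g $$ (i,j) = (1\<^sub>m n :: 'k mat) $$ (i,j)" for i j
  proof -
    have "(\<lambda>a::'k mat. a $$ (i,j) + - (1\<^sub>m n :: 'k mat) $$ (i,j)) \<in> poly_funs n"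
      by (intro poly_funs.add poly_funs.coord poly_funs.const ij)
    from this obtain p where p: "\<And>t. (1\<^sub>m n + t \<cdot>\<^sub>m \<xi>) $$ (i,j) + - (1\<^sub>m n :: 'k mat) $$ (i,j) = poly p t"
      "poly (pderiv p) 0 = 0"
      using x c unfolding lie_algebra_def by fastforce
    have "poly p t = poly [:0, \<xi> $$ (i,j):] t" for t
      using p(1)[of t] xc ij by simp
    then have "p = [:0, \<xi> $$ (i,j):]" by (simp add: poly_eq_poly_eq_iff[symmetric] fun_eq_iff)
    then show ?thesis using p(2) by (simp add: pderiv_pCons)
  qed
  have "\<xi> $$ (0,i) = 0 \<and> \<xi> $$ (i,0) = 0" if "i < n" for i
    using assms that by (cases "i = 0") (auto intro!: main simp: GL_sub_entries[OF assms])
  then show "\<xi> \<in> ?R" using xc by simp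
next
  fix \<xi> :: "'k mat" assume x: "\<xi> \<in> ?R"
  then have xc: "\<xi> \<in> carrier_mat n n" by simp
  obtain d where d: "\<And>t. det (1\<^sub>m n + t \<cdot>\<^sub>m \<xi>) = poly d t"
    using det_poly_fun[of "1\<^sub>m n" n \<xi>] xc by auto
  have "1\<^sub>m n + 0 \<cdot>\<^sub>m \<xi> = 1\<^sub>m n" using xc by (intro eq_matI) auto
  then have "poly d 0 = 1" using d[of 0] by simp
  then have d0: "d \<noteq> 0" by auto
  have "\<exists>p. (\<forall>t. f (1\<^sub>m n + t \<cdot>\<^sub>m \<xi>) = poly p t) \<and> poly (pderiv p) 0 = 0"
    if f: "f \<in> poly_funs n" "\<forall>g\<in>GL_sub n. f g = 0" for f
  proof -
    obtain p where p: "\<And>t. f (1\<^sub>m n + t \<cdot>\<^sub>m \<xi>) = poly p t"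
      using poly_funs_line[OF f(1), of "1\<^sub>m n" \<xi>] xc by auto
    have "poly (p * d) t = 0" for t
    proof (cases "poly d t = 0")
      case False
      then have "1\<^sub>m n + t \<cdot>\<^sub>m \<xi> \<in> GL_sub n"
        unfolding GL_sub_entries[OF assms] using x assms d[of t] by auto
      then show ?thesis using f(2) p[of t] by simp
    qed simp
    then have "p * d = 0" by (metis poly_all_0_iff_0)
    then have "p = 0" using d0 by simp
    then show ?thesis using p by (intro exI[of _ p]) simp
  qed
  then show "\<xi> \<in> lie_algebra n (GL_sub n)" using xc by (simp add: lie_algebra_def)
qed

end

(*
  Write v and f for the first basis vector and the first coordinate functional. If [xi, y] is
  orthogonal to q y for q = gl_(n-1), then [xi, y] is supported on the first row and column, and it
  lies in q y iff some z commuting with y satisfies z v = xi v and f z = f xi (then xi - z is in q).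
  Let m be the degree of the minimal polynomial of y and assume that the Hankel matrix
  (f y^(i+j) v), i, j < m, is nonsingular. Then the space is the direct sum of k[y] v and the
  annihilator of f k[y], z is determined on the first summand by z v, and on the second it can be
  taken with values in k[y] v and is then determined by f z. The two requirements are compatible
  because f [xi, y^k] v = 0. The Hankel condition is open, and it holds somewhere on the orbit:
  nondegeneracy means that f p_l(y) v is nonzero for the finitely many nonzero matrices p_l(y), where
  p_l = p / (X - l) for the roots l of the minimal polynomial p.
*)

theory Submission
  imports Defs
begin

subsection \<open>Moments of polynomials\<close>

text \<open>The linear functional on polynomials sending X^i to \<open>s i\<close>. For
  \<open>s k\<close> = f A^k v it is q |-> f q(A) v.\<close>

definition moment :: "(nat \<Rightarrow> 'k::comm_ring_1) \<Rightarrow> 'k poly \<Rightarrow> 'k" where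
  "moment s q = (\<Sum>i\<le>degree q. coeff q i * s i)"

lemma moment_bound:
  assumes "degree q \<le> N"
  shows "moment s q = (\<Sum>i\<le>N. coeff q i * s i)"
  unfolding moment_def using assms
  by (intro sum.mono_neutral_left) (auto simp: coeff_eq_0)

lemma moment_0 [simp]: "moment s 0 = 0"
  by (simp add: moment_def)

lemma moment_1 [simp]: "moment s 1 = s 0"
  by (simp add: moment_def)

lemma moment_add: "moment s (p + q) = moment s p + moment s q"
proof -
  let ?N = "max (degree p) (degree q)"
  have "moment s (p + q) = (\<Sum>i\<le>?N. coeff (p + q) i * s i)"
    by (intro moment_bound degree_add_le_max)
  also have "\<dots> = moment s p + moment s q"
    by (simp add: moment_bound[of p ?N] moment_bound[of q ?N] sum.distrib algebra_simps)
  finally show ?thesis .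
qed

lemma moment_smult: "moment s (Polynomial.smult c p) = c * moment s p"
  by (subst moment_bound[OF degree_smult_le]) (simp add: moment_def sum_distrib_left algebra_simps)

lemma moment_shift: "moment s (pCons 0 q) = moment (\<lambda>k. s (Suc k)) q"
proof -
  have "moment s (pCons 0 q) = (\<Sum>i\<le>Suc (degree q). coeff (pCons 0 q) i * s i)"
    by (intro moment_bound degree_pCons_le)
  also have "\<dots> = moment (\<lambda>k. s (Suc k)) q"
    by (subst sum.atMost_Suc_shift) (simp add: moment_def)
  finally show ?thesis .
qed

lemma moment_sum: "moment (\<lambda>k. \<Sum>x\<in>X. c x * s x k) q = (\<Sum>x\<in>X. c x * moment (s x) q)"
proof -
  have "moment (\<lambda>k. \<Sum>x\<in>X. c x * s x k) q
      = (\<Sum>i\<le>degree q. \<Sum>x\<in>X. c x * (coeff q i * s x i))"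
    unfolding moment_def by (intro sum.cong refl) (simp add: sum_distrib_left algebra_simps)
  also have "\<dots> = (\<Sum>x\<in>X. \<Sum>i\<le>degree q. c x * (coeff q i * s x i))"
    by (rule sum.swap)
  also have "\<dots> = (\<Sum>x\<in>X. c x * moment (s x) q)"
    by (simp add: moment_def sum_distrib_left)
  finally show ?thesis .
qed

lemma moment_poly_sum: "moment s (\<Sum>x\<in>X. f x) = (\<Sum>x\<in>X. moment s (f x))"
  by (induction X rule: infinite_finite_induct) (auto simp: moment_add)

lemma moment_monom_mult: "moment s (Polynomial.monom c i * q) = c * moment (\<lambda>k. s (i + k)) q"
proof (induction i arbitrary: s)
  case 0
  then show ?case by (simp add: monom_0 moment_smult)
next
  case (Suc i)
  then show ?case by (simp add: monom_Suc moment_shift)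
qed

text \<open>Horner induction on \<open>s\<close>: (a + X s) p = a p + X (s p). For a linear
  condition, stability under X is thus enough to get an ideal.\<close>

lemma poly_closed_under_mult:
  assumes 0: "P 0" and add: "\<And>p q. P p \<Longrightarrow> P q \<Longrightarrow> P (p + q)"
    and smult: "\<And>c p. P p \<Longrightarrow> P (Polynomial.smult c p)"
    and shift: "\<And>p. P p \<Longrightarrow> P (pCons 0 p)" and p: "P p"
  shows "P (s * p :: 'k::comm_ring_1 poly)"
proof (induction s)
  case (pCons a s)
  then show ?case by (simp add: add smult shift p)
qed (simp add: 0)


subsection \<open>The annihilator of a matrix\<close>

text \<open>The equation q(A) = 0, read entry by entry.\<close>

definition annihilates :: "nat \<Rightarrow> 'k::field mat \<Rightarrow> 'k poly \<Rightarrow> bool" where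
  "annihilates n A q \<longleftrightarrow> (\<forall>i<n. \<forall>j<n. moment (\<lambda>k. (A ^\<^sub>m k) $$ (i, j)) q = 0)"

lemma pow_mat_Suc_entry:
  fixes A :: "'k::field mat"
  assumes "A \<in> carrier_mat n n" "i < n" "j < n"
  shows "(A ^\<^sub>m Suc k) $$ (i, j) = (\<Sum>l<n. A $$ (l, j) * (A ^\<^sub>m k) $$ (i, l))"
  using assms pow_carrier_mat[OF assms(1), of k]
  by (auto simp: scalar_prod_def lessThan_atLeast0 mult.commute intro!: sum.cong)

text \<open>Each entry of (X p)(A) = p(A) A is a linear combination of entries of p(A).\<close>

lemma annihilates_mult:
  fixes A :: "'k::field mat"
  assumes A: "A \<in> carrier_mat n n" and "annihilates n A p"
  shows "annihilates n A (s * p)"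
proof (rule poly_closed_under_mult[of "annihilates n A"])
  fix p assume p: "annihilates n A p"
  have "moment (\<lambda>k. (A ^\<^sub>m k) $$ (i, j)) (pCons 0 p) = 0" if ij: "i < n" "j < n" for i j
  proof -
    have "moment (\<lambda>k. (A ^\<^sub>m k) $$ (i, j)) (pCons 0 p)
        = moment (\<lambda>k. \<Sum>l<n. A $$ (l, j) * (A ^\<^sub>m k) $$ (i, l)) p"
      unfolding moment_shift pow_mat_Suc_entry[OF A ij] ..
    also have "\<dots> = (\<Sum>l<n. A $$ (l, j) * moment (\<lambda>k. (A ^\<^sub>m k) $$ (i, l)) p)"
      by (rule moment_sum)
    also have "\<dots> = 0"
      using p ij by (simp add: annihilates_def)
    finally show ?thesis .
  qed
  then show "annihilates n A (pCons 0 p)" by (simp add: annihilates_def)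
qed (use assms in \<open>auto simp: annihilates_def moment_add moment_smult\<close>)

text \<open>The n^2 + 1 matrices A^0, ..., A^(n^2) lie in a space of dimension n^2, so they are
  linearly dependent.\<close>

lemma ex_annihilates:
  fixes A :: "'k::field mat"
  assumes "1 \<le> n"
  shows "\<exists>p. p \<noteq> 0 \<and> annihilates n A p"
proof -
  define N where "N = Suc (n * n)"
  \<comment> \<open>Column \<open>k\<close> lists the entries of A^k, with entry (i, j) in row i n +
    j. The extra zero row makes the matrix square and singular; a kernel vector supplies the
    coefficients of the polynomial.\<close>
  define M where "M = mat N N (\<lambda>(r, k). if r < n * n then (A ^\<^sub>m k) $$ (r div n, r mod n) else 0)"
  have M: "M \<in> carrier_mat N N" by (simp add: M_def)
  have "transpose_mat M *\<^sub>v unit_vec N (n * n) = 0\<^sub>v N"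
    by (rule eq_vecI) (auto simp: M_def N_def scalar_prod_def unit_vec_def intro!: sum.neutral)
  moreover have "unit_vec N (n * n) \<noteq> (0\<^sub>v N :: 'k vec)"
    by (simp add: N_def)
  ultimately have "det (transpose_mat M) = 0"
    using det_0_iff_vec_prod_zero_field[of "transpose_mat M" N] M unit_vec_carrier[of N "n * n"]
    by (metis transpose_carrier_mat)
  then have "det M = 0" using det_transpose[OF M] by simp
  then obtain v where v: "v \<in> carrier_vec N" "v \<noteq> 0\<^sub>v N" "M *\<^sub>v v = 0\<^sub>v N"
    using det_0_iff_vec_prod_zero_field[OF M] by auto
  define p where "p = (\<Sum>k<N. Polynomial.monom (v $ k) k)"
  have c: "coeff p k = (if k < N then v $ k else 0)" for k
    by (simp add: p_def coeff_sum)
  obtain k where "k < N" "v $ k \<noteq> 0" using v by (metis eq_vecI carrier_vecD index_zero_vec)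
  then have "p \<noteq> 0" using c[of k] by auto
  have deg: "degree p \<le> n * n" by (rule degree_le) (simp add: c N_def)
  have "moment (\<lambda>k. (A ^\<^sub>m k) $$ (i, j)) p = 0" if "i < n" "j < n" for i j
  proof -
    define r where "r = i * n + j"
    have "Suc i * n \<le> n * n" using that by (intro mult_le_mono1) simp
    then have r: "r < n * n" "r div n = i" "r mod n = j"
      using that by (simp_all add: r_def)
    have "0 = (M *\<^sub>v v) $ r" using v r by (simp add: N_def)
    also have "\<dots> = (\<Sum>k<N. (A ^\<^sub>m k) $$ (i, j) * v $ k)"
      using r v(1) by (simp add: M_def N_def scalar_prod_def lessThan_atLeast0)
    also have "\<dots> = (\<Sum>k\<le>n * n. coeff p k * (A ^\<^sub>m k) $$ (i, j))"
      by (intro sum.cong) (auto simp: c N_def)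
    finally show ?thesis using moment_bound[OF deg] by simp
  qed
  then show ?thesis using \<open>p \<noteq> 0\<close> by (auto simp: annihilates_def)
qed

section \<open>Avoiding the zeros of finitely many polynomials or bilinear forms\<close>

lemma finite_avoid:
  fixes P :: "'k::field_char_0 poly set"
  assumes "finite P" "0 \<notin> P"
  shows "\<exists>t. \<forall>q\<in>P. poly q t \<noteq> 0"
proof -
  \<comment> \<open>The product is a nonzero polynomial, hence has a nonzero value over an infinite
    field; no factor vanishes there.\<close>
  have "\<Prod>P \<noteq> 0" using assms by (metis prod_zero_iff)
  then obtain t where "poly (\<Prod>P) t \<noteq> 0"
    by (metis poly_all_0_iff_0)
  then show ?thesis using assms by (auto simp: poly_prod)
qed

text \<open>
  On the curve \<open>u = (t\<^sup>i)\<^sub>i\<close>, \<open>v = (t\<^sup>n\<^sup>j)\<^sub>j\<close> a bilinear form restricts to a polynomial in \<open>t\<close>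
  whose coefficients are exactly the entries of its matrix.
\<close>

lemma bilinear_avoid:
  fixes S :: "(nat \<Rightarrow> nat \<Rightarrow> 'k::field_char_0) set"
  assumes "finite S" and "\<And>B. B \<in> S \<Longrightarrow> \<exists>i<n. \<exists>j<n. B i j \<noteq> 0"
  shows "\<exists>u v. u 0 = 1 \<and> (\<forall>B\<in>S. (\<Sum>i<n. \<Sum>j<n. u i * v j * B i j) \<noteq> 0)"
proof -
  define Q where "Q B = (\<Sum>i<n. \<Sum>j<n. Polynomial.monom (B i j) (i + n * j))"
    for B :: "nat \<Rightarrow> nat \<Rightarrow> 'k"
  have "Q B \<noteq> 0" if B: "B \<in> S" for B
  proof -
    obtain a b where ab: "a < n" "b < n" "B a b \<noteq> 0" using assms(2)[OF B] by auto
    \<comment> \<open>Division with remainder by \<open>n\<close> recovers both indices from the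
      exponent, so no two monomials merge.\<close>
    have eq: "i + n * j = a + n * b \<longleftrightarrow> j = b \<and> i = a" if "i < n" for i j
    proof
      assume *: "i + n * j = a + n * b"
      have "(i + n * j) mod n = i" "(i + n * j) div n = j" using that by auto
      moreover have "(a + n * b) mod n = a" "(a + n * b) div n = b" using ab by auto
      ultimately show "j = b \<and> i = a" using * by simp
    qed simp
    have "coeff (Q B) (a + n * b) = (\<Sum>i<n. \<Sum>j<n. if i + n * j = a + n * b then B i j else 0)"
      by (simp add: Q_def coeff_sum)
    also have "\<dots> = (\<Sum>i<n. \<Sum>j<n. if j = b then if i = a then B i j else 0 else 0)"
      by (intro sum.cong refl) (auto simp: eq)
    also have "\<dots> = B a b" using ab by simp
    finally show ?thesis using ab by auto
  qed
  then obtain t where t: "\<And>B. B \<in> S \<Longrightarrow> poly (Q B) t \<noteq> 0"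
    using finite_avoid[of "Q ` S"] assms(1) by fastforce
  have "(\<Sum>i<n. \<Sum>j<n. t ^ i * t ^ (n * j) * B i j) = poly (Q B) t" for B
    by (simp add: Q_def poly_sum poly_monom power_add algebra_simps)
  \<comment> \<open>\<open>u 0 = t ^ 0 = 1\<close> even for \<open>t = 0\<close>; this entry becomes
    the pivot in \<open>ex_basis_change\<close>.\<close>
  then show ?thesis using t
    by (intro exI[of _ "\<lambda>i. t ^ i"] exI[of _ "\<lambda>j. t ^ (n * j)"]) simp
qed

subsection \<open>Nondegenerate Hankel matrices\<close>

definition hankel :: "nat \<Rightarrow> (nat \<Rightarrow> 'k) \<Rightarrow> 'k mat" where
  "hankel m s = mat m m (\<lambda>(i, j). s (i + j))"

lemma hankel_carrier [simp]: "hankel m s \<in> carrier_mat m m"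
  by (simp add: hankel_def)

text \<open>
  A kernel vector of the Hankel matrix gives a proper divisor \<open>d\<close> of \<open>p\<close> such that the moments
  of all multiples of \<open>d\<close> vanish; one of these multiples is \<open>p / (X - l)\<close> for a root \<open>l\<close>.
\<close>

lemma det_hankel_nonzero:
  fixes p :: "'k::alg_closed_field poly"
  assumes p: "p \<noteq> 0" and ideal: "\<And>q. moment s (q * p) = 0"
    and roots: "\<And>l q. p = [:- l, 1:] * q \<Longrightarrow> moment s q \<noteq> 0"
  shows "det (hankel (degree p) s) \<noteq> 0"
proof
  define m where "m = degree p"
  define J where "J d \<longleftrightarrow> (\<forall>q. moment s (q * d) = 0)" for d
  assume "det (hankel (degree p) s) = 0"
  then obtain a where a: "a \<in> carrier_vec m" "a \<noteq> 0\<^sub>v m" "hankel m s *\<^sub>v a = 0\<^sub>v m"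
    using det_0_iff_vec_prod_zero_field[OF hankel_carrier] m_def by blast
  define r where "r = (\<Sum>k<m. Polynomial.monom (a $ k) k)"
  have c: "coeff r k = (if k < m then a $ k else 0)" for k
    by (simp add: r_def coeff_sum)
  obtain k where k: "k < m" "a $ k \<noteq> 0" using a by (metis eq_vecI carrier_vecD index_zero_vec)
  then have "r \<noteq> 0" using c[of k] by auto
  have deg: "degree r \<le> m - 1" by (rule degree_le) (auto simp: c)
  \<comment> \<open>Row \<open>i\<close> of the kernel equation says that the functional vanishes on
    X^i \<open>r\<close>.\<close>
  have shifted: "moment (\<lambda>k. s (i + k)) r = 0" if "i < m" for i
  proof -
    have "moment (\<lambda>k. s (i + k)) r = (\<Sum>k\<le>m - 1. coeff r k * s (i + k))"
      by (rule moment_bound[OF deg])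
    also have "\<dots> = (\<Sum>k<m. s (i + k) * a $ k)"
      using k by (intro sum.cong) (auto simp: c)
    also have "\<dots> = (hankel m s *\<^sub>v a) $ i"
      using that a(1) by (simp add: hankel_def scalar_prod_def lessThan_atLeast0)
    finally show ?thesis using a(3) that by simp
  qed
  \<comment> \<open>Modulo \<open>p\<close>, whose multiples have moment zero, the multiplier
    \<open>q\<close> can be replaced by its remainder of degree below \<open>m\<close>, and there
    \<open>shifted\<close> applies.\<close>
  have "J r" unfolding J_def
  proof
    fix q
    define t where "t = q mod p"
    have "t = 0 \<or> degree t < m" unfolding t_def m_def by (rule degree_mod_less[OF p])
    then have t: "coeff t i = 0 \<or> i < m" for i
      using le_degree[of t i] by fastforce
    have "moment s (t * r) = moment s ((\<Sum>i\<le>degree t. Polynomial.monom (coeff t i) i) * r)"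
      by (simp add: poly_as_sum_of_monoms)
    also have "\<dots> = (\<Sum>i\<le>degree t. coeff t i * moment (\<lambda>k. s (i + k)) r)"
      by (simp add: sum_distrib_right moment_poly_sum moment_monom_mult)
    also have "\<dots> = 0" using t shifted by (intro sum.neutral) (metis mult_eq_0_iff)
    finally have 0: "moment s (t * r) = 0" .
    have "q * r = (q div p * p + t) * r" unfolding t_def by (simp only: div_mult_mod_eq)
    also have "\<dots> = (q div p * r) * p + t * r" by (simp add: algebra_simps)
    finally show "moment s (q * r) = 0" by (simp add: moment_add ideal 0)
  qed
  \<comment> \<open>\<open>J\<close> defines an ideal that contains \<open>p\<close>, so an element
    \<open>d\<close> of least degree divides \<open>p\<close>.\<close>
  then obtain d where d: "d \<noteq> 0" "J d" and min: "\<And>e. e \<noteq> 0 \<Longrightarrow> J e \<Longrightarrow> degree d \<le> degree e"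
    using ex_has_least_nat[of "\<lambda>d. d \<noteq> 0 \<and> J d" r degree] \<open>r \<noteq> 0\<close> by blast
  have "degree d \<le> m - 1" using min[OF \<open>r \<noteq> 0\<close> \<open>J r\<close>] deg by simp
  \<comment> \<open>\<open>k < m\<close> excludes \<open>m = 0\<close>, where \<open>m - 1\<close>
    would be truncated.\<close>
  then have dm: "degree d < m" using k by simp
  have "J (p mod d)" unfolding J_def
  proof
    fix q
    have "q * p = q * (p div d * d + p mod d)" by (simp only: div_mult_mod_eq)
    also have "\<dots> = (q * (p div d)) * d + q * (p mod d)" by (simp only: distrib_left mult.assoc)
    finally show "moment s (q * (p mod d)) = 0"
      using ideal[of q] d(2) by (simp add: J_def moment_add)
  qed
  then have "p mod d = 0"
    using min[of "p mod d"] degree_mod_less[OF d(1), of p] by fastforce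
  then obtain e where e: "p = d * e" by (metis mod_eq_0_iff_dvd dvdE)
  have "e \<noteq> 0" using p e by auto
  \<comment> \<open>The cofactor of \<open>d\<close> is not constant and so has a root
    \<open>l\<close>; then p / (X - l) is a multiple of \<open>d\<close> and has moment zero,
    against \<open>roots\<close>.\<close>
  then have "degree e > 0" using dm d(1) unfolding m_def e by (simp add: degree_mult_eq)
  then obtain l where "poly e l = 0" using alg_closed_imp_poly_has_root by blast
  then obtain e' where e': "e = [:- l, 1:] * e'" by (metis poly_eq_0_iff_dvd dvdE)
  then have "p = [:- l, 1:] * (e' * d)" unfolding e e' by (simp only: ac_simps)
  then show False using roots d(2) by (auto simp: J_def)
qed

text \<open>Here \<open>m\<close> is the degree of the minimal polynomial \<open>p\<close> of
  \<open>A\<close>, and \<open>u\<close>, \<open>v\<close> are chosen off finitely many bilinear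
  conditions, one for each p / (X - l) and one for u v.\<close>

lemma ex_hankel_nonzero:
  fixes A :: "'k::{alg_closed_field, field_char_0} mat"
  assumes n: "1 \<le> n" and A: "A \<in> carrier_mat n n"
  shows "\<exists>m a u v. 1 \<le> m \<and> (\<forall>i<n. \<forall>j<n. (A ^\<^sub>m m) $$ (i, j) = (\<Sum>k<m. a k * (A ^\<^sub>m k) $$ (i, j))) \<and>
    u 0 \<noteq> 0 \<and> (\<Sum>i<n. u i * v i) = 1 \<and>
    det (hankel m (\<lambda>k. \<Sum>i<n. \<Sum>j<n. u i * v j * (A ^\<^sub>m k) $$ (i, j))) \<noteq> 0"
proof -
  define B where "B q i j = moment (\<lambda>k. (A ^\<^sub>m k) $$ (i, j)) q" for q i j
  obtain p where p: "p \<noteq> 0" "annihilates n A p"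
    and min: "\<And>q. q \<noteq> 0 \<Longrightarrow> annihilates n A q \<Longrightarrow> degree p \<le> degree q"
    using ex_has_least_nat[of "\<lambda>q. q \<noteq> 0 \<and> annihilates n A q" _ degree] ex_annihilates[OF n, of A]
    by metis
  define m where "m = degree p"
  have m: "1 \<le> m"
  proof (rule ccontr)
    assume "\<not> 1 \<le> m"
    then have "degree p = 0" by (simp add: m_def)
    then obtain c where c: "p = [:c:]" by (rule degree_eq_zeroE)
    have "moment (\<lambda>k. (A ^\<^sub>m k) $$ (0, 0)) p = c" using n A by (simp add: c moment_def)
    then show False using p n c by (simp add: annihilates_def)
  qed
  \<comment> \<open>The equation p(A) = 0 solved for its top power A^m.\<close>
  define a where "a k = - coeff p k / lead_coeff p" for k
  have rec: "(A ^\<^sub>m m) $$ (i, j) = (\<Sum>k<m. a k * (A ^\<^sub>m k) $$ (i, j))" if "i < n" "j < n" for i j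
  proof -
    have "0 = (\<Sum>k\<le>m. coeff p k * (A ^\<^sub>m k) $$ (i, j))"
      using p(2) that by (simp add: annihilates_def moment_def m_def)
    also have "\<dots> = (\<Sum>k<m. coeff p k * (A ^\<^sub>m k) $$ (i, j)) + lead_coeff p * (A ^\<^sub>m m) $$ (i, j)"
      by (simp add: m_def flip: lessThan_Suc_atMost)
    finally have "(A ^\<^sub>m m) $$ (i, j) = - (\<Sum>k<m. coeff p k * (A ^\<^sub>m k) $$ (i, j)) / lead_coeff p"
      using p(1) by (simp add: field_simps eq_neg_iff_add_eq_0)
    also have "\<dots> = (\<Sum>k<m. a k * (A ^\<^sub>m k) $$ (i, j))"
      by (simp add: a_def sum_divide_distrib sum_negf)
    finally show ?thesis .
  qed
  \<comment> \<open>The cofactors are what \<open>det_hankel_nonzero\<close> asks about; the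
    polynomial 1 is added because its moment is u v, which must be nonzero to be normalized.\<close>
  define S where "S = insert 1 ((\<lambda>l. p div [:- l, 1:]) ` {l. poly p l = 0})"
  have fin: "finite S" using poly_roots_finite[OF p(1)] by (simp add: S_def)
  have quot: "q \<in> S" if "p = [:- l, 1:] * q" for l q
  proof -
    have "[:- l, 1:] * q div [:- l, 1:] = q" by (rule nonzero_mult_div_cancel_left) simp
    then have "q = p div [:- l, 1:]" by (simp only: that)
    moreover have "poly p l = 0" unfolding that by simp
    ultimately show ?thesis by (auto simp: S_def)
  qed
  \<comment> \<open>A cofactor has smaller degree than \<open>p\<close>, so by minimality it does
    not annihilate \<open>A\<close>; the polynomial 1 gives the identity matrix.\<close>
  have nonzero: "\<exists>i<n. \<exists>j<n. B q i j \<noteq> 0" if q: "q \<in> S" for q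
  proof (cases "q = 1")
    case True
    then show ?thesis using n A by (auto simp: B_def intro!: exI[of _ 0])
  next
    case False
    then obtain l where l: "poly p l = 0" "q = p div [:- l, 1:]" using q by (auto simp: S_def)
    then have eq: "p = [:- l, 1:] * q" by (simp only: poly_eq_0_iff_dvd dvd_mult_div_cancel)
    then have "q \<noteq> 0" using p(1) by auto
    then have "degree p = degree [:- l, 1:] + degree q" unfolding eq by (intro degree_mult_eq) auto
    then have "degree q < degree p" by simp
    then have "\<not> annihilates n A q" using min[OF \<open>q \<noteq> 0\<close>] by auto
    then show ?thesis by (auto simp: annihilates_def B_def)
  qed
  have "\<exists>i<n. \<exists>j<n. C i j \<noteq> 0" if "C \<in> B ` S" for C
    using that nonzero by blast
  from bilinear_avoid[OF finite_imageI[OF fin] this] obtain u v where uv: "u 0 = 1"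
    "\<And>q. q \<in> S \<Longrightarrow> (\<Sum>i<n. \<Sum>j<n. u i * v j * B q i j) \<noteq> 0"
    by blast
  define c where "c = (\<Sum>i<n. u i * v i)"
  have "(\<Sum>i<n. \<Sum>j<n. u i * v j * B 1 i j) = c"
    unfolding c_def using A
    by (intro sum.cong refl) (simp add: B_def if_distrib cong: if_cong)
  then have c: "c \<noteq> 0" using uv(2)[of 1] by (simp add: S_def)
  \<comment> \<open>Rescaling the row makes its product with \<open>v\<close> equal to 1 and divides
    every moment by the nonzero \<open>c\<close>.\<close>
  define w where "w i = u i / c" for i
  define s where "s k = (\<Sum>i<n. \<Sum>j<n. w i * v j * (A ^\<^sub>m k) $$ (i, j))" for k
  have "s = (\<lambda>k. \<Sum>(i, j)\<in>{..<n} \<times> {..<n}. w i * v j * (A ^\<^sub>m k) $$ (i, j))"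
    by (simp add: s_def fun_eq_iff sum.cartesian_product)
  then have "moment s q = (\<Sum>(i, j)\<in>{..<n} \<times> {..<n}. w i * v j * B q i j)" for q
    using moment_sum[of "\<lambda>(i, j). w i * v j" "\<lambda>(i, j) k. (A ^\<^sub>m k) $$ (i, j)" "{..<n} \<times> {..<n}"]
    by (simp add: B_def case_prod_unfold)
  then have mom: "moment s q = (\<Sum>i<n. \<Sum>j<n. w i * v j * B q i j)" for q
    by (simp add: sum.cartesian_product)
  have mom': "moment s q = (\<Sum>i<n. \<Sum>j<n. u i * v j * B q i j) / c" for q
    unfolding mom w_def by (simp add: sum_divide_distrib)
  have "det (hankel m s) \<noteq> 0" unfolding m_def
  proof (rule det_hankel_nonzero[OF p(1)])
    show "moment s (q * p) = 0" for q
      using annihilates_mult[OF A p(2), of q] by (simp add: mom B_def annihilates_def)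
    show "moment s q \<noteq> 0" if "p = [:- l, 1:] * q" for l q
      using uv(2)[OF quot[OF that]] c by (simp add: mom')
  qed
  moreover have "(\<Sum>i<n. w i * v i) = 1" using c
    by (simp add: w_def c_def flip: sum_divide_distrib)
  moreover have "w 0 \<noteq> 0" using uv c by (auto simp: w_def)
  ultimately show ?thesis using m rec unfolding s_def by blast
qed

subsection \<open>Elements of the centralizer with prescribed first row and column\<close>

declare index_mult_mat(1) [simp del]

lemma mat_mult_entry:
  fixes X :: "'k::comm_ring_1 mat"
  assumes "X \<in> carrier_mat a b" "Y \<in> carrier_mat b c" "i < a" "j < c"
  shows "(X * Y) $$ (i, j) = (\<Sum>l<b. X $$ (i, l) * Y $$ (l, j))"
  using assms by (simp add: index_mult_mat(1) scalar_prod_def lessThan_atLeast0)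

lemma mat_mult_assoc_dim:
  fixes X :: "'k::comm_ring_1 mat"
  assumes "dim_col X = dim_row Y" "dim_col Y = dim_row Z"
  shows "X * Y * Z = X * (Y * Z)"
  using assms by (intro assoc_mult_mat) auto

lemma pow_mat_Suc_left:
  fixes A :: "'k::comm_ring_1 mat"
  assumes A: "A \<in> carrier_mat n n"
  shows "A ^\<^sub>m Suc k = A * A ^\<^sub>m k"
proof (induction k)
  case 0
  then show ?case using A by simp
next
  case (Suc k)
  have "A ^\<^sub>m Suc (Suc k) = (A * A ^\<^sub>m k) * A" using Suc by simp
  also have "\<dots> = A * (A ^\<^sub>m k * A)" using A by (intro mat_mult_assoc_dim) auto
  finally show ?case by simp
qed

lemma pow_mat_add:
  fixes A :: "'k::comm_ring_1 mat"
  assumes A: "A \<in> carrier_mat n n"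
  shows "A ^\<^sub>m (i + j) = A ^\<^sub>m i * A ^\<^sub>m j"
proof (induction j)
  case 0
  then show ?case using right_mult_one_mat[OF pow_carrier_mat[OF A]] A by simp
next
  case (Suc j)
  have "A ^\<^sub>m (i + Suc j) = A ^\<^sub>m i * A ^\<^sub>m j * A" using Suc by simp
  also have "\<dots> = A ^\<^sub>m i * (A ^\<^sub>m j * A)" using A by (intro mat_mult_assoc_dim) auto
  finally show ?case by simp
qed

text \<open>Moving from left to right through the product, \<open>A\<close> turns into
  \<open>K\<close>, then \<open>L\<close>, then \<open>A\<close> again.\<close>

lemma commute_sandwich:
  fixes A :: "'k::comm_ring_1 mat"
  assumes [simp]: "A \<in> carrier_mat n n" "C \<in> carrier_mat n m" "R \<in> carrier_mat m n"
    "K \<in> carrier_mat m m" "L \<in> carrier_mat m m" "G \<in> carrier_mat m m"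
    and AC: "A * C = C * K" and RA: "R * A = L * R" and KG: "K * G = G * L"
  shows "A * (C * G * R) = C * G * R * A"
proof -
  note d [simp] = carrier_matD[OF assms(1)] carrier_matD[OF assms(2)] carrier_matD[OF assms(3)]
    carrier_matD[OF assms(4)] carrier_matD[OF assms(5)] carrier_matD[OF assms(6)]
  have "A * (C * G * R) = (A * C) * (G * R)" by (simp add: mat_mult_assoc_dim)
  also have "\<dots> = C * ((K * G) * R)" unfolding AC by (simp add: mat_mult_assoc_dim)
  also have "\<dots> = C * (G * (R * A))" unfolding KG RA by (simp add: mat_mult_assoc_dim)
  also have "\<dots> = C * G * R * A" by (simp add: mat_mult_assoc_dim)
  finally show ?thesis .
qed

text \<open>Let G be the inverse of R C. The term C' G R does what is wanted on \<open>C\<close>,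
  and C G R' does what is wanted under \<open>R\<close>. Each also contributes to the other
  condition, and by \<open>comp\<close> the same term C G (R C') G R corrects both excesses.\<close>

lemma ex_commuting_extension:
  fixes A :: "'k::field mat"
  assumes A: "A \<in> carrier_mat n n" and C: "C \<in> carrier_mat n m" "C' \<in> carrier_mat n m"
    and R: "R \<in> carrier_mat m n" "R' \<in> carrier_mat m n"
    and K: "K \<in> carrier_mat m m" "L \<in> carrier_mat m m"
    and AC: "A * C = C * K" "A * C' = C' * K" and RA: "R * A = L * R" "R' * A = L * R'"
    and comp: "R * C' = R' * C" and det: "det (R * C) \<noteq> 0"
  shows "\<exists>z\<in>carrier_mat n n. A * z = z * A \<and> z * C = C' \<and> R * z = R'"
proof -
  note d [simp] = A C R K carrier_matD[OF A] carrier_matD[OF C(1)] carrier_matD[OF C(2)] carrier_matD[OF R(1)]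
    carrier_matD[OF R(2)] carrier_matD[OF K(1)] carrier_matD[OF K(2)]
  have H [simp]: "R * C \<in> carrier_mat m m" by (rule mult_carrier_mat[OF R(1) C(1)])
  obtain G where G [simp]: "G \<in> carrier_mat m m" and GH: "G * (R * C) = 1\<^sub>m m" "(R * C) * G = 1\<^sub>m m"
    using det_non_zero_imp_unit[OF H det] by (auto simp: Units_def ring_mat_def)
  note Gd [simp] = carrier_matD[OF G]
  \<comment> \<open>R X intertwines \<open>K\<close> and \<open>L\<close>; this is used for both
    \<open>C\<close> and \<open>C'\<close>.\<close>
  have KX: "(R * X) * K = L * (R * X)" if X: "X \<in> carrier_mat n m" "A * X = X * K" for X
  proof -
    note carrier_matD[OF X(1), simp]
    have "(R * X) * K = R * (A * X)" unfolding X(2) by (simp add: mat_mult_assoc_dim)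
    also have "\<dots> = (R * A) * X" by (simp add: mat_mult_assoc_dim)
    also have "\<dots> = L * (R * X)" unfolding RA by (simp add: mat_mult_assoc_dim)
    finally show ?thesis .
  qed
  note KH = KX[OF C(1) AC(1)] and KH' = KX[OF C(2) AC(2)]
  \<comment> \<open>Multiplying (R C) K = L (R C) by the inverse on both sides makes
    \<open>G\<close> an intertwiner in the opposite direction, as \<open>commute_sandwich\<close>
    requires.\<close>
  have "K * G = (G * (R * C)) * (K * G)" unfolding GH by simp
  also have "\<dots> = G * (((R * C) * K) * G)" by (simp add: mat_mult_assoc_dim)
  also have "\<dots> = G * L * ((R * C) * G)" unfolding KH by (simp add: mat_mult_assoc_dim)
  also have "\<dots> = G * L" unfolding GH by simp
  finally have KG: "K * G = G * L" .
  define H' where "H' = R * C'"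
  have H' [simp]: "H' \<in> carrier_mat m m" unfolding H'_def by (rule mult_carrier_mat[OF R(1) C(2)])
  note H'd [simp] = carrier_matD[OF H']
  have "K * (G * H' * G) = (K * G) * H' * G" by (simp add: mat_mult_assoc_dim)
  also have "\<dots> = G * (L * H') * G" unfolding KG by (simp add: mat_mult_assoc_dim)
  also have "\<dots> = G * H' * (K * G)" unfolding H'_def KH'[symmetric] unfolding H'_def[symmetric]
    by (simp add: mat_mult_assoc_dim)
  also have "\<dots> = (G * H' * G) * L" unfolding KG by (simp add: mat_mult_assoc_dim)
  finally have KG': "K * (G * H' * G) = (G * H' * G) * L" .
  define T1 T2 T3 where "T1 = C' * G * R" and "T2 = C * G * R'" and "T3 = C * (G * H' * G) * R"
  have T [simp]: "T1 \<in> carrier_mat n n" "T2 \<in> carrier_mat n n" "T3 \<in> carrier_mat n n"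
    unfolding T1_def T2_def T3_def by (intro carrier_matI; simp)+
  have "A * T1 = T1 * A" unfolding T1_def
    by (rule commute_sandwich[OF _ _ _ _ _ _ AC(2) RA(1) KG]) auto
  moreover have "A * T2 = T2 * A" unfolding T2_def
    by (rule commute_sandwich[OF _ _ _ _ _ _ AC(1) RA(2) KG]) auto
  moreover have "A * T3 = T3 * A" unfolding T3_def
    by (rule commute_sandwich[OF A C(1) R(1) K _ AC(1) RA(1) KG'], rule carrier_matI) simp_all
  ultimately have comm: "A * (T1 + T2 - T3) = (T1 + T2 - T3) * A"
    by (simp add: mult_minus_distrib_mat[of _ n n _ n] minus_mult_distrib_mat[of _ n n _ _ n]
        mult_add_distrib_mat[of _ n n _ n] add_mult_distrib_mat[of _ n n _ _ n])
  have "T1 * C = C' * (G * (R * C))" unfolding T1_def by (simp add: mat_mult_assoc_dim)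
  then have 1: "T1 * C = C'" by (simp add: GH)
  have 2: "T2 * C = C * G * H'" unfolding T2_def H'_def comp by (simp add: mat_mult_assoc_dim)
  have "T3 * C = C * G * H' * (G * (R * C))" unfolding T3_def by (simp add: mat_mult_assoc_dim)
  also have "\<dots> = C * G * H'" unfolding GH by (rule right_mult_one_mat[of _ n], rule carrier_matI) simp_all
  finally have 3: "T3 * C = C * G * H'" .
  have "(T1 + T2 - T3) * C = T1 * C + T2 * C - T3 * C"
    by (simp add: minus_mult_distrib_mat[of _ n n _ _ m] add_mult_distrib_mat[of _ n n _ _ m])
  also have "\<dots> = C'" unfolding 1 2 3 by (intro eq_matI) auto
  finally have zC: "(T1 + T2 - T3) * C = C'" .
  have 4: "R * T1 = H' * G * R" unfolding T1_def H'_def by (simp add: mat_mult_assoc_dim)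
  have "R * T2 = ((R * C) * G) * R'" unfolding T2_def by (simp add: mat_mult_assoc_dim)
  then have 5: "R * T2 = R'" by (simp add: GH)
  have "R * T3 = ((R * C) * G) * (H' * G * R)" unfolding T3_def by (simp add: mat_mult_assoc_dim)
  also have "\<dots> = H' * G * R" unfolding GH by (rule left_mult_one_mat[of _ _ n], rule carrier_matI) simp_all
  finally have 6: "R * T3 = H' * G * R" .
  have "R * (T1 + T2 - T3) = R * T1 + R * T2 - R * T3"
    by (simp add: mult_minus_distrib_mat[of _ m n _ n] mult_add_distrib_mat[of _ m n _ n])
  also have "\<dots> = R'" unfolding 4 5 6 by (intro eq_matI) auto
  finally have "R * (T1 + T2 - T3) = R'" .
  moreover have "T1 + T2 - T3 \<in> carrier_mat n n" by (simp add: minus_carrier_mat)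
  ultimately show ?thesis using comm zC by blast
qed

text \<open>If z commutes with A and z e_0 = \<xi> e_0, then z A^j e_0 = A^j \<xi> e_0, and dually
  for rows. With these columns and rows \<open>ex_commuting_extension\<close> applies: R C is the
  Hankel matrix, and its compatibility condition is \<open>comp\<close> at the exponent i +
  j.\<close>

lemma ex_centralizer:
  fixes A \<xi> :: "'k::field mat"
  assumes A [simp]: "A \<in> carrier_mat n n" and \<xi> [simp]: "\<xi> \<in> carrier_mat n n"
    and n: "1 \<le> n" and m: "1 \<le> m"
    and rec: "\<And>i j. i < n \<Longrightarrow> j < n \<Longrightarrow> (A ^\<^sub>m m) $$ (i, j) = (\<Sum>k<m. a k * (A ^\<^sub>m k) $$ (i, j))"
    and det: "det (hankel m (\<lambda>k. (A ^\<^sub>m k) $$ (0, 0))) \<noteq> 0"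
    and comp: "\<And>k. (\<xi> * A ^\<^sub>m k) $$ (0, 0) = (A ^\<^sub>m k * \<xi>) $$ (0, 0)"
  shows "\<exists>z\<in>carrier_mat n n. A * z = z * A \<and>
    (\<forall>i<n. z $$ (i, 0) = \<xi> $$ (i, 0) \<and> z $$ (0, i) = \<xi> $$ (0, i))"
proof -
  define cols where "cols B = mat n m (\<lambda>(i, j). (A ^\<^sub>m j * B) $$ (i, 0))" for B
  define rows where "rows B = mat m n (\<lambda>(i, j). (B * A ^\<^sub>m i) $$ (0, j))" for B
  \<comment> \<open>The companion matrix of the recurrence: a column before the last one shifts the
    exponent by one, and the last column rewrites A^m by \<open>a\<close>.\<close>
  define K where "K = mat m m (\<lambda>(l, j). if Suc j = m then a l else if l = Suc j then 1 else 0)"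
  define L where "L = transpose_mat K"
  note [simp] = pow_carrier_mat[OF A] carrier_matD[OF A] carrier_matD[OF \<xi>]
  have [simp]: "cols B \<in> carrier_mat n m" "rows B \<in> carrier_mat m n"
    "K \<in> carrier_mat m m" "L \<in> carrier_mat m m" for B
    by (simp_all add: cols_def rows_def K_def L_def)
  have AC: "A * cols B = cols B * K" if B [simp]: "B \<in> carrier_mat n n" for B
  proof (rule eq_matI)
    note [simp] = carrier_matD[OF B]
    fix i j assume "i < dim_row (cols B * K)" "j < dim_col (cols B * K)"
    then have ij: "i < n" "j < m" by (simp_all add: cols_def K_def)
    have "(A * cols B) $$ (i, j) = (\<Sum>l<n. A $$ (i, l) * (A ^\<^sub>m j * B) $$ (l, 0))"
      using ij by (simp add: mat_mult_entry[of _ n n _ m] cols_def)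
    also have "\<dots> = (A * (A ^\<^sub>m j * B)) $$ (i, 0)"
      using ij n by (intro mat_mult_entry[symmetric]) auto
    also have "A * (A ^\<^sub>m j * B) = A ^\<^sub>m Suc j * B"
      unfolding pow_mat_Suc_left[OF A] by (simp add: mat_mult_assoc_dim)
    also have "(A ^\<^sub>m Suc j * B) $$ (i, 0) = (\<Sum>l<m. (A ^\<^sub>m l * B) $$ (i, 0) * K $$ (l, j))"
    proof (cases "Suc j = m")
      case True
      have "(A ^\<^sub>m Suc j * B) $$ (i, 0) = (\<Sum>r<n. (A ^\<^sub>m m) $$ (i, r) * B $$ (r, 0))"
        using ij n by (subst True, intro mat_mult_entry) auto
      also have "\<dots> = (\<Sum>r<n. \<Sum>l<m. a l * ((A ^\<^sub>m l) $$ (i, r) * B $$ (r, 0)))"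
        by (intro sum.cong refl, subst rec) (use ij in \<open>auto simp: sum_distrib_right mult.assoc\<close>)
      also have "\<dots> = (\<Sum>l<m. \<Sum>r<n. a l * ((A ^\<^sub>m l) $$ (i, r) * B $$ (r, 0)))"
        by (rule sum.swap)
      also have "\<dots> = (\<Sum>l<m. (A ^\<^sub>m l * B) $$ (i, 0) * K $$ (l, j))"
        using ij n True
        by (simp add: mat_mult_entry[of _ n n _ n] K_def sum_distrib_left mult.commute[of _ "a _"])
      finally show ?thesis .
    next
      case False
      then have "Suc j < m" using ij by simp
      then show ?thesis using ij
        by (simp add: K_def if_distrib[of "\<lambda>x. _ * x"] sum.delta' del: pow_mat.simps cong: if_cong)
    qed
    also have "\<dots> = (cols B * K) $$ (i, j)"
      using ij by (simp add: mat_mult_entry[of _ n m _ m] cols_def)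
    finally show "(A * cols B) $$ (i, j) = (cols B * K) $$ (i, j)" .
  qed (simp_all add: cols_def K_def)
  have RA: "rows B * A = L * rows B" if B [simp]: "B \<in> carrier_mat n n" for B
  proof (rule eq_matI)
    note [simp] = carrier_matD[OF B]
    fix i j assume "i < dim_row (L * rows B)" "j < dim_col (L * rows B)"
    then have ij: "i < m" "j < n" by (simp_all add: rows_def K_def L_def)
    have "(rows B * A) $$ (i, j) = (\<Sum>l<n. (B * A ^\<^sub>m i) $$ (0, l) * A $$ (l, j))"
      using ij by (simp add: mat_mult_entry[of _ m n _ n] rows_def)
    also have "\<dots> = (B * A ^\<^sub>m i * A) $$ (0, j)"
      using ij n by (intro mat_mult_entry[symmetric]) auto
    also have "B * A ^\<^sub>m i * A = B * A ^\<^sub>m Suc i"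
      by (simp add: mat_mult_assoc_dim)
    also have "(B * A ^\<^sub>m Suc i) $$ (0, j) = (\<Sum>l<m. K $$ (l, i) * (B * A ^\<^sub>m l) $$ (0, j))"
    proof (cases "Suc i = m")
      case True
      have "(B * A ^\<^sub>m Suc i) $$ (0, j) = (\<Sum>r<n. B $$ (0, r) * (A ^\<^sub>m m) $$ (r, j))"
        using ij n by (subst True, intro mat_mult_entry) auto
      also have "\<dots> = (\<Sum>r<n. \<Sum>l<m. a l * (B $$ (0, r) * (A ^\<^sub>m l) $$ (r, j)))"
        by (intro sum.cong refl, subst rec) (use ij in \<open>auto simp: sum_distrib_left mult.left_commute\<close>)
      also have "\<dots> = (\<Sum>l<m. \<Sum>r<n. a l * (B $$ (0, r) * (A ^\<^sub>m l) $$ (r, j)))"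
        by (rule sum.swap)
      also have "\<dots> = (\<Sum>l<m. K $$ (l, i) * (B * A ^\<^sub>m l) $$ (0, j))"
        using ij n True
        by (simp add: mat_mult_entry[of _ n n _ n] K_def sum_distrib_left)
      finally show ?thesis .
    next
      case False
      then have "Suc i < m" using ij by simp
      then show ?thesis using ij
        by (simp add: K_def if_distrib[of "\<lambda>x. x * _"] sum.delta' del: pow_mat.simps cong: if_cong)
    qed
    also have "\<dots> = (L * rows B) $$ (i, j)"
      using ij by (simp add: mat_mult_entry[of _ m m _ n] rows_def L_def K_def)
    finally show "(rows B * A) $$ (i, j) = (L * rows B) $$ (i, j)" .
  qed (simp_all add: rows_def K_def L_def)
  have RC: "rows B * cols B' = mat m m (\<lambda>(i, j). (B * A ^\<^sub>m (i + j) * B') $$ (0, 0))"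
    if B [simp]: "B \<in> carrier_mat n n" "B' \<in> carrier_mat n n" for B B'
  proof (rule eq_matI, goal_cases)
    case (1 i j)
    then have ij: "i < m" "j < m" by simp_all
    note [simp] = carrier_matD[OF B(1)] carrier_matD[OF B(2)]
    have "(rows B * cols B') $$ (i, j) = (\<Sum>l<n. (B * A ^\<^sub>m i) $$ (0, l) * (A ^\<^sub>m j * B') $$ (l, 0))"
      using ij by (simp add: mat_mult_entry[of _ m n _ m] rows_def cols_def)
    also have "\<dots> = (B * A ^\<^sub>m i * (A ^\<^sub>m j * B')) $$ (0, 0)"
      using n by (intro mat_mult_entry[symmetric]) auto
    also have "B * A ^\<^sub>m i * (A ^\<^sub>m j * B') = B * A ^\<^sub>m (i + j) * B'"
      unfolding pow_mat_add[OF A] by (simp add: mat_mult_assoc_dim)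
    finally show ?case using ij by simp
  qed (simp_all add: rows_def cols_def)
  have 1 [simp]: "1\<^sub>m n \<in> carrier_mat n n" by simp
  have "rows (1\<^sub>m n) * cols \<xi> = rows \<xi> * cols (1\<^sub>m n)"
    unfolding RC[OF 1 \<xi>] RC[OF \<xi> 1]
    using comp left_mult_one_mat[OF pow_carrier_mat[OF A]] right_mult_one_mat[of "\<xi> * A ^\<^sub>m _" n n]
    by (intro cong_mat) simp_all
  moreover have "rows (1\<^sub>m n) * cols (1\<^sub>m n) = hankel m (\<lambda>k. (A ^\<^sub>m k) $$ (0, 0))"
    unfolding RC[OF 1 1] hankel_def
    using left_mult_one_mat[OF pow_carrier_mat[OF A]] right_mult_one_mat[OF pow_carrier_mat[OF A]]
    by (intro cong_mat) simp_all
  ultimately obtain z where z: "z \<in> carrier_mat n n" "A * z = z * A"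
    and zC: "z * cols (1\<^sub>m n) = cols \<xi>" and Rz: "rows (1\<^sub>m n) * z = rows \<xi>"
    using ex_commuting_extension[of A n "cols (1\<^sub>m n)" m "cols \<xi>" "rows (1\<^sub>m n)" "rows \<xi>" K L]
      AC[OF 1] AC[OF \<xi>] RA[OF 1] RA[OF \<xi>] det by auto
  have "z $$ (i, 0) = \<xi> $$ (i, 0) \<and> z $$ (0, i) = \<xi> $$ (0, i)" if i: "i < n" for i
  proof
    \<comment> \<open>Column 0 of \<open>cols (1\<^sub>m n)\<close> exists because
      \<open>1 \<le> m\<close>, and it is the first basis vector because its exponent is 0.\<close>
    have "(z * cols (1\<^sub>m n)) $$ (i, 0) = (\<Sum>l<n. z $$ (i, l) * (if l = 0 then 1 else 0))"
      using z(1) i m n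
      by (simp add: mat_mult_entry[of _ n n _ m]) (simp add: cols_def)
    also have "\<dots> = z $$ (i, 0)" using n by (simp add: if_distrib cong: if_cong)
    finally show "z $$ (i, 0) = \<xi> $$ (i, 0)" using zC i m n by (simp add: cols_def)
    have "(rows (1\<^sub>m n) * z) $$ (0, i) = (\<Sum>l<n. (if l = 0 then 1 else 0) * z $$ (l, i))"
      using z(1) i m n
      by (simp add: mat_mult_entry[of _ m n _ n])
        (auto simp: rows_def intro!: sum.cong)
    also have "\<dots> = z $$ (0, i)" using n by (simp add: if_distrib[of "\<lambda>x. x * _"] cong: if_cong)
    finally show "z $$ (0, i) = \<xi> $$ (0, i)" using Rz i m n by (simp add: rows_def)
  qed
  then show ?thesis using z by blast
qed

subsection \<open>Tangent vectors orthogonal to the subalgebra\<close>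

text \<open>The trace is cyclic and y commutes with its powers.\<close>

lemma mat_trace_bracket_pow:
  fixes y :: "'k::field mat"
  assumes [simp]: "y \<in> carrier_mat n n" "\<xi> \<in> carrier_mat n n"
  shows "mat_trace (bracket \<xi> y * y ^\<^sub>m k) = 0"
proof -
  note [simp] = carrier_matD[OF assms(1)] carrier_matD[OF assms(2)] pow_carrier_mat[OF assms(1)]
  have "bracket \<xi> y * y ^\<^sub>m k = \<xi> * y * y ^\<^sub>m k - y * \<xi> * y ^\<^sub>m k"
    unfolding bracket_def by (rule minus_mult_distrib_mat[of _ n n _ _ n]) (auto intro: mult_carrier_mat)
  also have "\<xi> * y * y ^\<^sub>m k = \<xi> * (y ^\<^sub>m k * y)"
    using pow_mat_Suc_left[OF assms(1), of k] by (simp add: mat_mult_assoc_dim)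
  also have "y * \<xi> * y ^\<^sub>m k = y * (\<xi> * y ^\<^sub>m k)"
    by (simp add: mat_mult_assoc_dim)
  finally have "mat_trace (bracket \<xi> y * y ^\<^sub>m k)
      = mat_trace (\<xi> * (y ^\<^sub>m k * y)) - mat_trace (y * (\<xi> * y ^\<^sub>m k))"
    by (simp add: mat_trace_minus[of _ n] mult_carrier_mat[of _ n n])
  also have "mat_trace (y * (\<xi> * y ^\<^sub>m k)) = mat_trace (\<xi> * y ^\<^sub>m k * y)"
    by (rule mat_trace_comm[of _ n n]) (auto intro: mult_carrier_mat)
  also have "\<xi> * y ^\<^sub>m k * y = \<xi> * (y ^\<^sub>m k * y)"
    by (simp add: mat_mult_assoc_dim)
  finally show ?thesis by simp
qed

text \<open>The Leibniz rule for [\<xi>, y^k]. In the induction one factor y is split off on the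
  right, and \<xi> y = [\<xi>, y] + y \<xi>; the column index varies because that factor sums over
  it.\<close>

lemma bracket_pow_entry:
  fixes y :: "'k::field mat"
  assumes y [simp]: "y \<in> carrier_mat n n" and \<xi> [simp]: "\<xi> \<in> carrier_mat n n"
    and ij: "i < n" "j < n"
  shows "(\<xi> * y ^\<^sub>m k) $$ (i, j) = (y ^\<^sub>m k * \<xi>) $$ (i, j)
    + (\<Sum>r<k. (y ^\<^sub>m r * bracket \<xi> y * y ^\<^sub>m (k - 1 - r)) $$ (i, j))"
  using ij(2)
proof (induction k arbitrary: j)
  case 0
  then show ?case
    using left_mult_one_mat[OF \<xi>] right_mult_one_mat[OF \<xi>] carrier_matD[OF y] by simp
next
  case (Suc k)
  define u where "u = bracket \<xi> y"
  note d [simp] = carrier_matD[OF y] carrier_matD[OF \<xi>]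
  have u [simp]: "u \<in> carrier_mat n n" by (simp add: u_def bracket_def minus_carrier_mat mult_carrier_mat[of _ n n])
  note [simp] = carrier_matD[OF u]
  have entry: "(X * y) $$ (i, j) = (\<Sum>l<n. X $$ (i, l) * y $$ (l, j))" if "X \<in> carrier_mat n n" for X
    using that ij Suc.prems by (intro mat_mult_entry) auto
  have [simp]: "X * Y \<in> carrier_mat n n" if "X \<in> carrier_mat n n" "Y \<in> carrier_mat n n" for X Y :: "'k mat"
    using that by (rule mult_carrier_mat)
  have "(\<xi> * y ^\<^sub>m Suc k) $$ (i, j) = (\<xi> * y ^\<^sub>m k * y) $$ (i, j)"
    by (simp add: mat_mult_assoc_dim)
  also have "\<dots> = (\<Sum>l<n. (\<xi> * y ^\<^sub>m k) $$ (i, l) * y $$ (l, j))"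
    by (rule entry) simp
  also have "\<dots> = (\<Sum>l<n. (y ^\<^sub>m k * \<xi>) $$ (i, l) * y $$ (l, j))
      + (\<Sum>l<n. \<Sum>r<k. (y ^\<^sub>m r * u * y ^\<^sub>m (k - 1 - r)) $$ (i, l) * y $$ (l, j))"
    by (simp add: Suc.IH distrib_right sum.distrib sum_distrib_right u_def)
  also have "(\<Sum>l<n. (y ^\<^sub>m k * \<xi>) $$ (i, l) * y $$ (l, j)) = (y ^\<^sub>m k * \<xi> * y) $$ (i, j)"
    by (rule entry[symmetric]) simp
  also have "y ^\<^sub>m k * \<xi> * y = y ^\<^sub>m k * (\<xi> * y)"
    by (simp add: mat_mult_assoc_dim)
  also have "\<xi> * y = u + y * \<xi>"
    unfolding u_def bracket_def by (intro eq_matI) auto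
  also have "y ^\<^sub>m k * (u + y * \<xi>) = y ^\<^sub>m k * u + y ^\<^sub>m Suc k * \<xi>"
    by (simp add: mult_add_distrib_mat[of _ n n _ n] mat_mult_assoc_dim)
  also have "(y ^\<^sub>m k * u + y ^\<^sub>m Suc k * \<xi>) $$ (i, j) = (y ^\<^sub>m k * u) $$ (i, j) + (y ^\<^sub>m Suc k * \<xi>) $$ (i, j)"
    using ij Suc.prems by simp
  also have "(\<Sum>l<n. \<Sum>r<k. (y ^\<^sub>m r * u * y ^\<^sub>m (k - 1 - r)) $$ (i, l) * y $$ (l, j))
      = (\<Sum>r<k. (y ^\<^sub>m r * u * y ^\<^sub>m (Suc k - 1 - r)) $$ (i, j))"
  proof (subst sum.swap, intro sum.cong refl)
    fix r assume "r \<in> {..<k}"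
    then have r: "Suc k - 1 - r = Suc (k - 1 - r)" by auto
    have "(\<Sum>l<n. (y ^\<^sub>m r * u * y ^\<^sub>m (k - 1 - r)) $$ (i, l) * y $$ (l, j))
        = (y ^\<^sub>m r * u * y ^\<^sub>m (k - 1 - r) * y) $$ (i, j)"
      by (rule entry[symmetric]) simp
    also have "y ^\<^sub>m r * u * y ^\<^sub>m (k - 1 - r) * y = y ^\<^sub>m r * u * y ^\<^sub>m (Suc k - 1 - r)"
      unfolding r by (simp add: mat_mult_assoc_dim)
    finally show "(\<Sum>l<n. (y ^\<^sub>m r * u * y ^\<^sub>m (k - 1 - r)) $$ (i, l) * y $$ (l, j))
        = (y ^\<^sub>m r * u * y ^\<^sub>m (Suc k - 1 - r)) $$ (i, j)" .
  qed
  \<comment> \<open>The leftover y^k u is the new summand \<open>r = k\<close>, whose right factor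
    is y^0.\<close>
  finally show ?case
    using right_mult_one_mat[OF mult_carrier_mat[OF pow_carrier_mat[OF y] u]] by (simp add: u_def del: pow_mat.simps(2))
qed

text \<open>
  If \<open>[\<xi>, y]\<close> is supported on the first row and column, its pairings with powers of \<open>y\<close> split
  into a row part and a column part; these cancel in the telescoping sum for \<open>[\<xi>, y\<^sup>k]\<close>.
\<close>

lemma first_entry_commute:
  fixes y :: "'k::field mat"
  assumes y [simp]: "y \<in> carrier_mat n n" and \<xi> [simp]: "\<xi> \<in> carrier_mat n n" and n: "1 \<le> n"
    and supp: "\<And>i j. 0 < i \<Longrightarrow> i < n \<Longrightarrow> 0 < j \<Longrightarrow> j < n \<Longrightarrow> bracket \<xi> y $$ (i, j) = 0"
  shows "(\<xi> * y ^\<^sub>m k) $$ (0, 0) = (y ^\<^sub>m k * \<xi>) $$ (0, 0)"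
proof -
  define u where "u = bracket \<xi> y"
  have u [simp]: "u \<in> carrier_mat n n" by (simp add: u_def bracket_def minus_carrier_mat mult_carrier_mat[of _ n n])
  note [simp] = carrier_matD[OF y] carrier_matD[OF u] pow_carrier_mat[OF y]
  have trace: "(\<Sum>i<n. \<Sum>j<n. u $$ (i, j) * (y ^\<^sub>m r) $$ (j, i)) = 0" for r
  proof -
    have "mat_trace (u * y ^\<^sub>m r) = (\<Sum>i<n. \<Sum>j<n. u $$ (i, j) * (y ^\<^sub>m r) $$ (j, i))"
      by (simp add: mat_trace_def mat_mult_entry[of _ n n _ n])
    then show ?thesis using mat_trace_bracket_pow[OF y \<xi>, of r] by (simp add: u_def)
  qed
  \<comment> \<open>The trace of u is its corner entry. Once this is zero, the row part and the
    column part no longer overlap.\<close>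
  have "(\<Sum>i<n. \<Sum>j<n. u $$ (i, j) * (y ^\<^sub>m 0) $$ (j, i)) = (\<Sum>i<n. if i = 0 then u $$ (0, 0) else 0)"
    using supp by (intro sum.cong refl) (auto simp: u_def if_distrib cong: if_cong)
  then have u00: "u $$ (0, 0) = 0" using trace[of 0] n by simp
  have split: "(\<Sum>i<n. \<Sum>j<n. f i * u $$ (i, j) * g j)
      = f 0 * (\<Sum>j<n. u $$ (0, j) * g j) + (\<Sum>i<n. f i * u $$ (i, 0)) * g 0" for f g
  proof -
    have "(\<Sum>i<n. \<Sum>j<n. f i * u $$ (i, j) * g j)
        = (\<Sum>i<n. \<Sum>j<n. (if i = 0 then f 0 * (u $$ (0, j) * g j) else 0)
            + (if j = 0 then f i * u $$ (i, 0) * g 0 else 0))"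
      using supp u00 by (intro sum.cong refl) (auto simp: u_def mult.assoc)
    also have "\<dots> = (\<Sum>j<n. f 0 * (u $$ (0, j) * g j)) + (\<Sum>i<n. f i * u $$ (i, 0) * g 0)"
    proof -
      have "(\<Sum>i<n. \<Sum>j<n. if i = 0 then f 0 * (u $$ (0, j) * g j) else 0)
          = (\<Sum>j<n. \<Sum>i<n. if i = 0 then f 0 * (u $$ (0, j) * g j) else 0)"
        by (rule sum.swap)
      then show ?thesis using n by (simp add: sum.distrib)
    qed
    finally show ?thesis by (simp add: sum_distrib_left sum_distrib_right)
  qed
  define \<alpha> where "\<alpha> r = (\<Sum>j<n. u $$ (0, j) * (y ^\<^sub>m r) $$ (j, 0))" for r
  define \<beta> where "\<beta> r = (\<Sum>i<n. (y ^\<^sub>m r) $$ (0, i) * u $$ (i, 0))" for r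
  define s where "s r = (y ^\<^sub>m r) $$ (0, 0)" for r
  have \<alpha>\<beta>: "\<alpha> r + \<beta> r = 0" for r
  proof -
    have "0 = (\<Sum>i<n. \<Sum>j<n. u $$ (i, j) * (y ^\<^sub>m r) $$ (j, i))"
      by (simp only: trace)
    also have "\<dots> = (\<Sum>i<n. \<Sum>j<n. (if i = 0 then u $$ (0, j) * (y ^\<^sub>m r) $$ (j, 0) else 0)
        + (if j = 0 then (y ^\<^sub>m r) $$ (0, i) * u $$ (i, 0) else 0))"
      using supp u00 by (intro sum.cong refl) (auto simp: u_def)
    also have "\<dots> = \<alpha> r + \<beta> r"
    proof -
      have "(\<Sum>i<n. \<Sum>j<n. if i = 0 then u $$ (0, j) * (y ^\<^sub>m r) $$ (j, 0) else 0)
          = (\<Sum>j<n. \<Sum>i<n. if i = 0 then u $$ (0, j) * (y ^\<^sub>m r) $$ (j, 0) else 0)"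
        by (rule sum.swap)
      then show ?thesis using n by (simp add: sum.distrib \<alpha>_def \<beta>_def)
    qed
    finally show ?thesis by simp
  qed
  have entry: "(y ^\<^sub>m r * u * y ^\<^sub>m t) $$ (0, 0) = s r * \<alpha> t + \<beta> r * s t" for r t
  proof -
    have "(y ^\<^sub>m r * u * y ^\<^sub>m t) $$ (0, 0)
        = (\<Sum>j<n. (y ^\<^sub>m r * u) $$ (0, j) * (y ^\<^sub>m t) $$ (j, 0))"
      using n by (intro mat_mult_entry) (auto intro: mult_carrier_mat)
    also have "\<dots> = (\<Sum>j<n. \<Sum>i<n. (y ^\<^sub>m r) $$ (0, i) * u $$ (i, j) * (y ^\<^sub>m t) $$ (j, 0))"
      using n by (simp add: mat_mult_entry[of _ n n _ n] sum_distrib_right)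
    also have "\<dots> = (\<Sum>i<n. \<Sum>j<n. (y ^\<^sub>m r) $$ (0, i) * u $$ (i, j) * (y ^\<^sub>m t) $$ (j, 0))"
      by (rule sum.swap)
    finally show ?thesis by (simp add: split s_def \<alpha>_def \<beta>_def)
  qed
  have "(\<Sum>r<k. (y ^\<^sub>m r * u * y ^\<^sub>m (k - 1 - r)) $$ (0, 0))
      = (\<Sum>r<k. s r * \<alpha> (k - Suc r)) + (\<Sum>r<k. \<beta> r * s (k - Suc r))"
    by (simp add: entry sum.distrib)
  \<comment> \<open>Reversing the order of summation aligns the row terms with the column terms, so
    that \<open>\<alpha> r + \<beta> r\<close> can be factored out.\<close>
  also have "(\<Sum>r<k. s r * \<alpha> (k - Suc r)) = (\<Sum>r<k. s (k - Suc r) * \<alpha> (k - Suc (k - Suc r)))"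
    by (rule sum.nat_diff_reindex[symmetric])
  also have "\<dots> = (\<Sum>r<k. s (k - Suc r) * \<alpha> r)"
    by (intro sum.cong refl) auto
  also have "\<dots> + (\<Sum>r<k. \<beta> r * s (k - Suc r)) = (\<Sum>r<k. s (k - Suc r) * (\<alpha> r + \<beta> r))"
    by (simp add: sum.distrib[symmetric] algebra_simps)
  finally show ?thesis
    using bracket_pow_entry[OF y \<xi>, of 0 0 k] n by (simp add: \<alpha>\<beta> u_def)
qed

text \<open>Orthogonality gives the support condition, hence \<open>first_entry_commute\<close>,
  hence a centralizing \<open>z\<close> with the first row and column of \<xi>; subtracting it
  leaves the bracket unchanged.\<close>

lemma kks_perp_subset:
  fixes y :: "'k::field_char_0 mat"
  assumes n: "1 \<le> n" and m: "1 \<le> m" and y [simp]: "y \<in> carrier_mat n n"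
    and rec: "\<And>i j. i < n \<Longrightarrow> j < n \<Longrightarrow> (y ^\<^sub>m m) $$ (i, j) = (\<Sum>k<m. a k * (y ^\<^sub>m k) $$ (i, j))"
    and det: "det (hankel m (\<lambda>k. (y ^\<^sub>m k) $$ (0, 0))) \<noteq> 0"
  shows "kks_perp n y (inf_orbit (lie_algebra n (GL_sub n)) y) \<subseteq> inf_orbit (lie_algebra n (GL_sub n)) y"
proof
  fix w assume w: "w \<in> kks_perp n y (inf_orbit (lie_algebra n (GL_sub n)) y)"
  then obtain \<xi> where \<xi> [simp]: "\<xi> \<in> carrier_mat n n" and w_eq: "w = bracket \<xi> y"
    by (auto simp: kks_perp_def inf_orbit_def)
  have wc [simp]: "w \<in> carrier_mat n n"
    by (simp add: w_eq bracket_def minus_carrier_mat mult_carrier_mat[of _ n n])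
  have supp: "bracket \<xi> y $$ (i, j) = 0" if ij: "0 < i" "i < n" "0 < j" "j < n" for i j
  proof -
    note wd = carrier_matD[OF wc]
    \<comment> \<open>The matrix unit at the transposed position, so that the trace of
      \<open>w * E\<close> is the entry of \<open>w\<close> at (i, j).\<close>
    define E where "E = mat n n (\<lambda>(k, l). if k = j \<and> l = i then 1 else (0::'k))"
    have E [simp]: "E \<in> carrier_mat n n" by (simp add: E_def)
    have "E \<in> lie_algebra n (GL_sub n)"
      using ij by (auto simp: lie_algebra_GL_sub[OF n] E_def)
    then have "kks n y (bracket \<xi> y) (bracket E y) = 0"
      using w by (simp add: kks_perp_def inf_orbit_def w_eq)
    then have "mat_trace (w * E) = 0"
      using kks_bracket[OF y \<xi> E] mat_trace_bracket(1)[OF y \<xi> E] by (simp add: w_eq)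
    moreover have "mat_trace (w * E) = (\<Sum>k<n. \<Sum>l<n. if l = j then if k = i then w $$ (k, l) else 0 else 0)"
      by (simp add: wd mat_trace_def mat_mult_entry[of _ n n _ n])
        (auto simp: E_def if_distrib[of "\<lambda>x. _ * x"] intro!: sum.cong cong: if_cong)
    ultimately show ?thesis using ij by (simp add: w_eq)
  qed
  obtain z where z [simp]: "z \<in> carrier_mat n n" and yz: "y * z = z * y"
    and zent: "\<And>i. i < n \<Longrightarrow> z $$ (i, 0) = \<xi> $$ (i, 0) \<and> z $$ (0, i) = \<xi> $$ (0, i)"
    using ex_centralizer[OF y \<xi> n m rec det first_entry_commute[OF y \<xi> n supp]] by blast
  have "\<xi> - z \<in> lie_algebra n (GL_sub n)"
    using zent n carrier_matD[OF z] by (auto simp: lie_algebra_GL_sub[OF n] minus_carrier_mat)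
  moreover have "bracket (\<xi> - z) y = w"
  proof -
    have "bracket (\<xi> - z) y = (\<xi> * y - z * y) - (y * \<xi> - y * z)"
      unfolding bracket_def
      by (simp add: minus_mult_distrib_mat[of _ n n _ _ n] mult_minus_distrib_mat[of _ n n _ n])
    also have "\<dots> = w" unfolding w_eq bracket_def yz using carrier_matD[OF z] carrier_matD[OF y] carrier_matD[OF \<xi>]
      by (intro eq_matI) auto
    finally show ?thesis .
  qed
  ultimately show "w \<in> inf_orbit (lie_algebra n (GL_sub n)) y"
    by (auto simp: inf_orbit_def)
qed

subsection \<open>The open subset of the orbit\<close>

lemma poly_funs_sum:
  "finite I \<Longrightarrow> (\<And>i. i \<in> I \<Longrightarrow> f i \<in> poly_funs n) \<Longrightarrow> (\<lambda>a. \<Sum>i\<in>I. f i a) \<in> poly_funs n"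
  by (induction I rule: finite_induct) (auto intro: poly_funs.intros)

lemma poly_funs_prod:
  "finite I \<Longrightarrow> (\<And>i. i \<in> I \<Longrightarrow> f i \<in> poly_funs n) \<Longrightarrow> (\<lambda>a. \<Prod>i\<in>I. f i a) \<in> poly_funs n"
  by (induction I rule: finite_induct) (auto intro: poly_funs.intros)

text \<open>Agreement holds on \<open>carrier_mat n n\<close> only: for other sizes the matrix
  product sums over a different index range.\<close>

lemma poly_funs_pow_entry:
  assumes "i < n" "j < n"
  shows "\<exists>f\<in>poly_funs n. \<forall>a\<in>carrier_mat n n. f a = ((a :: 'k::field mat) ^\<^sub>m k) $$ (i, j)"
  using assms(2)
proof (induction k arbitrary: j)
  case 0
  then show ?case using assms(1)
    by (intro bexI[OF _ poly_funs.const[of "if i = j then 1 else 0"]]) auto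
next
  case (Suc k)
  then obtain f where f: "\<And>l. l < n \<Longrightarrow> f l \<in> poly_funs n"
    "\<And>l a. l < n \<Longrightarrow> a \<in> carrier_mat n n \<Longrightarrow> f l a = ((a :: 'k mat) ^\<^sub>m k) $$ (i, l)"
    by metis
  have "(\<lambda>a. \<Sum>l<n. a $$ (l, j) * f l a) \<in> poly_funs n"
    using f(1) Suc.prems by (auto intro!: poly_funs_sum poly_funs.mult poly_funs.coord)
  then show ?case
    by (rule bexI[rotated]) (use f(2) assms(1) Suc.prems in \<open>simp add: pow_mat_Suc_entry del: pow_mat.simps\<close>)
qed

text \<open>The Leibniz formula writes the determinant as a polynomial in entries of powers of the
  matrix.\<close>

lemma poly_funs_det_hankel:
  assumes "1 \<le> n"
  shows "\<exists>f\<in>poly_funs n. \<forall>a\<in>carrier_mat n n.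
    f a = det (hankel m (\<lambda>k. ((a :: 'k::field mat) ^\<^sub>m k) $$ (0, 0)))"
proof -
  have "\<forall>k. \<exists>f. f \<in> poly_funs n \<and> (\<forall>a\<in>carrier_mat n n. f a = ((a :: 'k mat) ^\<^sub>m k) $$ (0, 0))"
    using poly_funs_pow_entry[of 0 n 0] assms by auto
  from choice[OF this] obtain f where f: "\<And>k. f k \<in> poly_funs n"
    "\<And>k a. a \<in> carrier_mat n n \<Longrightarrow> f k a = ((a :: 'k mat) ^\<^sub>m k) $$ (0, 0)"
    by blast
  let ?F = "\<lambda>a. \<Sum>\<pi> | \<pi> permutes {0..<m}. signof \<pi> * (\<Prod>i = 0..<m. f (i + \<pi> i) a)"
  show ?thesis
  proof (rule bexI[of _ ?F], rule ballI)
    show "?F \<in> poly_funs n"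
      using f(1) by (intro poly_funs_sum poly_funs.mult poly_funs.const poly_funs_prod)
        (auto simp: finite_permutations)
    fix a :: "'k mat" assume a: "a \<in> carrier_mat n n"
    have "det (hankel m (\<lambda>k. (a ^\<^sub>m k) $$ (0, 0))) = (\<Sum>\<pi> | \<pi> permutes {0..<m}. signof \<pi> *
        (\<Prod>i = 0..<m. hankel m (\<lambda>k. (a ^\<^sub>m k) $$ (0, 0)) $$ (i, \<pi> i)))"
      by (rule det_def'[OF hankel_carrier])
    also have "\<dots> = ?F a"
    proof (rule sum.cong[OF refl])
      fix \<pi> assume "\<pi> \<in> {\<pi>. \<pi> permutes {0..<m}}"
      then have \<pi>: "\<pi> i < m" if "i < m" for i
        using that permutes_in_image[of \<pi> "{0..<m}" i] by simp
      have "(\<Prod>i = 0..<m. hankel m (\<lambda>k. (a ^\<^sub>m k) $$ (0, 0)) $$ (i, \<pi> i)) = (\<Prod>i = 0..<m. f (i + \<pi> i) a)"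
        by (intro prod.cong refl) (simp add: hankel_def f(2)[OF a] \<pi>)
      then show "signof \<pi> * (\<Prod>i = 0..<m. hankel m (\<lambda>k. (a ^\<^sub>m k) $$ (0, 0)) $$ (i, \<pi> i))
          = signof \<pi> * (\<Prod>i = 0..<m. f (i + \<pi> i) a)"
        by (simp only:)
    qed
    finally show "?F a = det (hankel m (\<lambda>k. (a ^\<^sub>m k) $$ (0, 0)))" by (rule sym)
  qed
qed

text \<open>
  Any row \<open>u\<close> and column \<open>v\<close> with \<open>u v = 1\<close> become the first row and first column after a
  change of basis: complete \<open>v\<close> by a basis of the kernel of \<open>u\<close>.
\<close>

lemma ex_basis_change:
  fixes u v :: "nat \<Rightarrow> 'k::field"
  assumes n: "1 \<le> n" and u0: "u 0 \<noteq> 0" and uv: "(\<Sum>i<n. u i * v i) = 1"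
  shows "\<exists>g\<in>carrier_mat n n. \<exists>h\<in>carrier_mat n n. g * h = 1\<^sub>m n \<and> h * g = 1\<^sub>m n \<and>
    (\<forall>i<n. g $$ (0, i) = u i \<and> h $$ (i, 0) = v i)"
proof -
  \<comment> \<open>Column 0 is v; column j > 0 is e_j - (u_j / u_0) e_0, which \<open>u\<close>
    sends to 0.\<close>
  define h where "h = mat n n (\<lambda>(i, j). if j = 0 then v i
    else if i = 0 then - u j / u 0 else if i = j then 1 else 0)"
  have h: "h \<in> carrier_mat n n" by (simp add: h_def)
  have uh: "(\<Sum>i<n. u i * h $$ (i, j)) = (if j = 0 then 1 else 0)" if j: "j < n" for j
  proof (cases "j = 0")
    case True
    then show ?thesis using uv n by (simp add: h_def)
  next
    case False
    have "(\<Sum>i<n. u i * h $$ (i, j)) = (\<Sum>i<n. (if i = 0 then - u j else 0) + (if i = j then u j else 0))"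
      using False j u0 by (intro sum.cong) (auto simp: h_def)
    also have "\<dots> = 0" using n j by (simp add: sum.distrib)
    finally show ?thesis using False by simp
  qed
  \<comment> \<open>Applying \<open>u\<close> to a kernel vector \<open>a\<close> gives a_0 = 0, and
    then row i > 0 of h a = 0 reads a_i = 0.\<close>
  have "det h \<noteq> 0"
  proof
    assume "det h = 0"
    then obtain a where a: "a \<in> carrier_vec n" "a \<noteq> 0\<^sub>v n" "h *\<^sub>v a = 0\<^sub>v n"
      using det_0_iff_vec_prod_zero_field[OF h] by auto
    have ha: "(\<Sum>j<n. h $$ (i, j) * a $ j) = 0" if "i < n" for i
    proof -
      have "(h *\<^sub>v a) $ i = (\<Sum>j<n. h $$ (i, j) * a $ j)"
        using h a(1) that by (simp add: scalar_prod_def lessThan_atLeast0)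
      then show ?thesis using a(3) that by simp
    qed
    have "0 = (\<Sum>i<n. u i * (\<Sum>j<n. h $$ (i, j) * a $ j))"
      using ha by simp
    also have "\<dots> = (\<Sum>i<n. \<Sum>j<n. u i * h $$ (i, j) * a $ j)"
      by (simp add: sum_distrib_left mult.assoc)
    also have "\<dots> = (\<Sum>j<n. \<Sum>i<n. u i * h $$ (i, j) * a $ j)"
      by (rule sum.swap)
    also have "\<dots> = (\<Sum>j<n. (if j = 0 then 1 else 0) * a $ j)"
      using uh by (simp flip: sum_distrib_right)
    also have "\<dots> = a $ 0"
      using n by (simp add: if_distrib[of "\<lambda>x. x * _"] cong: if_cong)
    finally have a0: "a $ 0 = 0" by simp
    have "a $ i = 0" if i: "i < n" for i
    proof (cases "i = 0")
      case False
      have "(\<Sum>j<n. h $$ (i, j) * a $ j) = (\<Sum>j<n. if j = i then a $ j else 0)"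
        using i False a0 by (intro sum.cong) (auto simp: h_def)
      then show ?thesis using ha[OF i] i by simp
    qed (simp add: a0)
    then show False using a(1,2) by (metis eq_vecI carrier_vecD index_zero_vec)
  qed
  then obtain g where g: "g \<in> carrier_mat n n" "g * h = 1\<^sub>m n" "h * g = 1\<^sub>m n"
    using det_non_zero_imp_unit[OF h] by (auto simp: Units_def ring_mat_def)
  \<comment> \<open>\<open>uh\<close> says that u h is the first unit row; multiply by the inverse
    \<open>g\<close> on the right.\<close>
  have "g $$ (0, i) = u i" if i: "i < n" for i
  proof -
    have "u i = (\<Sum>k<n. u k * (h * g) $$ (k, i))"
      using i by (simp add: g(3) if_distrib cong: if_cong)
    also have "\<dots> = (\<Sum>k<n. \<Sum>j<n. u k * h $$ (k, j) * g $$ (j, i))"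
      using i by (simp add: mat_mult_entry[OF h g(1)] sum_distrib_left mult.assoc)
    also have "\<dots> = (\<Sum>j<n. \<Sum>k<n. u k * h $$ (k, j) * g $$ (j, i))"
      by (rule sum.swap)
    also have "\<dots> = (\<Sum>j<n. (if j = 0 then 1 else 0) * g $$ (j, i))"
      using uh by (simp flip: sum_distrib_right)
    also have "\<dots> = g $$ (0, i)"
      using n by (simp add: if_distrib[of "\<lambda>x. x * _"] cong: if_cong)
    finally show ?thesis by simp
  qed
  moreover have "h $$ (i, 0) = v i" if "i < n" for i
    using that by (simp add: h_def)
  ultimately show ?thesis using g h by blast
qed

text \<open>At (0, 0), with the matrices of \<open>ex_basis_change\<close>, this is the sequence of
  \<open>ex_hankel_nonzero\<close>. At all (i, j) it carries linear relations between powers of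
  \<open>x\<close> along the orbit.\<close>

lemma conj_entry:
  fixes g :: "'k::field mat"
  assumes g: "g \<in> carrier_mat n n" and h: "h \<in> carrier_mat n n" and x: "x \<in> carrier_mat n n"
    and inv: "g * h = 1\<^sub>m n" "h * g = 1\<^sub>m n" and ij: "i < n" "j < n"
  shows "((g * x * h) ^\<^sub>m k) $$ (i, j) = (\<Sum>r<n. \<Sum>l<n. g $$ (i, r) * h $$ (l, j) * (x ^\<^sub>m k) $$ (r, l))"
proof -
  have "similar_mat_wit (g * x * h) x g h"
    using assms by (auto simp: similar_mat_wit_def Let_def mult_carrier_mat[of _ n n])
  then have "(g * x * h) ^\<^sub>m k = g * x ^\<^sub>m k * h"
    by (rule similar_mat_wit_pow_id)
  also have "(g * x ^\<^sub>m k * h) $$ (i, j) = (\<Sum>l<n. (g * x ^\<^sub>m k) $$ (i, l) * h $$ (l, j))"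
    by (rule mat_mult_entry[OF mult_carrier_mat[OF g pow_carrier_mat[OF x]] h ij])
  also have "\<dots> = (\<Sum>l<n. \<Sum>r<n. g $$ (i, r) * h $$ (l, j) * (x ^\<^sub>m k) $$ (r, l))"
    using ij by (intro sum.cong refl) (auto simp: mat_mult_entry[OF g pow_carrier_mat[OF x]]
        sum_distrib_right mult.assoc mult.commute[of "h $$ _"])
  also have "\<dots> = (\<Sum>r<n. \<Sum>l<n. g $$ (i, r) * h $$ (l, j) * (x ^\<^sub>m k) $$ (r, l))"
    by (rule sum.swap)
  finally show ?thesis .
qed

theorem theorem4p4:
  fixes x :: "'k::{alg_closed_field, field_char_0} mat" and n :: nat
  assumes "1 \<le> n" and "x \<in> carrier_mat n n"
  shows "coisotropic_action n (GL_sub n) x"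
proof -
  note n = assms(1) and x = assms(2)
  \<comment> \<open>The recurrence \<open>m\<close>, \<open>a\<close> serves every point of the
    orbit; \<open>u\<close> and \<open>v\<close> only produce one point where the Hankel determinant
    is nonzero.\<close>
  obtain m a u v where m: "1 \<le> m"
    and rec: "\<forall>i<n. \<forall>j<n. (x ^\<^sub>m m) $$ (i, j) = (\<Sum>k<m. a k * (x ^\<^sub>m k) $$ (i, j))"
    and uv: "u 0 \<noteq> 0" "(\<Sum>i<n. u i * v i) = 1"
    and det: "det (hankel m (\<lambda>k. \<Sum>i<n. \<Sum>j<n. u i * v j * (x ^\<^sub>m k) $$ (i, j))) \<noteq> 0"
    using ex_hankel_nonzero[OF n x] by (elim exE conjE) (rule that)
  define D where "D y = det (hankel m (\<lambda>k. (y ^\<^sub>m k) $$ (0, 0)))" for y :: "'k mat"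
  define U where "U = {y \<in> adjoint_orbit n x. D y \<noteq> 0}"
  have orbit: "\<exists>g h. g \<in> carrier_mat n n \<and> h \<in> carrier_mat n n \<and> g * h = 1\<^sub>m n \<and> h * g = 1\<^sub>m n \<and>
      y = g * x * h" if y: "y \<in> adjoint_orbit n x" for y
  proof -
    obtain g h where "g \<in> carrier_mat n n" "h \<in> carrier_mat n n" "inverts_mat g h" "inverts_mat h g"
      "y = g * x * h"
      using y by (auto simp: adjoint_orbit_def GL_def)
    then show ?thesis by (intro exI[of _ g] exI[of _ h]) (simp add: inverts_mat_def)
  qed
  have carrier: "y \<in> carrier_mat n n" if "y \<in> adjoint_orbit n x" for y
    using orbit[OF that] x by (auto intro!: mult_carrier_mat)
  obtain f where f: "f \<in> poly_funs n" "\<And>y. y \<in> carrier_mat n n \<Longrightarrow> f y = D y"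
    unfolding D_def using poly_funs_det_hankel[OF n, of m] by blast
  have "zariski_open_in n (adjoint_orbit n x) U"
    unfolding zariski_open_in_def
  proof (intro exI conjI)
    show "zariski_closed n {y \<in> carrier_mat n n. \<forall>f\<in>{f}. f y = 0}"
      unfolding zariski_closed_def using f(1) by (intro exI[of _ "{f}"]) auto
    show "U = adjoint_orbit n x - {y \<in> carrier_mat n n. \<forall>f\<in>{f}. f y = 0}"
      using carrier f(2) by (auto simp: U_def)
  qed
  moreover have "U \<noteq> {}"
  proof -
    obtain g h where g: "g \<in> carrier_mat n n" and h: "h \<in> carrier_mat n n"
      and inv: "g * h = 1\<^sub>m n" "h * g = 1\<^sub>m n"
      and entries: "\<And>i. i < n \<Longrightarrow> g $$ (0, i) = u i \<and> h $$ (i, 0) = v i"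
      using ex_basis_change[OF n uv] by blast
    have "invertible_mat g"
      using g h inv by (auto simp: invertible_mat_def inverts_mat_def square_mat.simps)
    then have "g * x * h \<in> adjoint_orbit n x"
      unfolding adjoint_orbit_def GL_def inverts_mat_def using g h inv by auto
    moreover have "D (g * x * h) \<noteq> 0"
      using det n entries by (simp add: D_def conj_entry[OF g h x inv])
    ultimately show ?thesis by (auto simp: U_def)
  qed
  moreover have "kks_perp n y (inf_orbit (lie_algebra n (GL_sub n)) y)
      \<subseteq> inf_orbit (lie_algebra n (GL_sub n)) y" if y: "y \<in> U" for y
  proof (rule kks_perp_subset[OF n m])
    show "y \<in> carrier_mat n n" using carrier y by (simp add: U_def)
    show "det (hankel m (\<lambda>k. (y ^\<^sub>m k) $$ (0, 0))) \<noteq> 0" using y by (simp add: U_def D_def)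
    obtain g h where gh: "g \<in> carrier_mat n n" "h \<in> carrier_mat n n" "g * h = 1\<^sub>m n" "h * g = 1\<^sub>m n"
      and y_eq: "y = g * x * h"
      using y orbit[of y] unfolding U_def by blast
    \<comment> \<open>Conjugation is linear and compatible with powers, so the recurrence passes
      from \<open>x\<close> to \<open>y\<close> with the same coefficients.\<close>
    show "(y ^\<^sub>m m) $$ (i, j) = (\<Sum>k<m. a k * (y ^\<^sub>m k) $$ (i, j))" if ij: "i < n" "j < n" for i j
    proof -
      let ?c = "\<lambda>r l. g $$ (i, r) * h $$ (l, j)"
      have entry: "(y ^\<^sub>m k) $$ (i, j) = (\<Sum>(r, l)\<in>{..<n} \<times> {..<n}. ?c r l * (x ^\<^sub>m k) $$ (r, l))" for k
        unfolding y_eq conj_entry[OF gh(1,2) x gh(3,4) ij] by (simp add: sum.cartesian_product)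
      have "(y ^\<^sub>m m) $$ (i, j)
          = (\<Sum>(r, l)\<in>{..<n} \<times> {..<n}. \<Sum>k<m. a k * (?c r l * (x ^\<^sub>m k) $$ (r, l)))"
        unfolding entry by (intro sum.cong) (auto simp: rec sum_distrib_left mult.left_commute)
      also have "\<dots> = (\<Sum>k<m. \<Sum>(r, l)\<in>{..<n} \<times> {..<n}. a k * (?c r l * (x ^\<^sub>m k) $$ (r, l)))"
        unfolding case_prod_unfold by (rule sum.swap)
      also have "\<dots> = (\<Sum>k<m. a k * (y ^\<^sub>m k) $$ (i, j))"
        unfolding entry by (simp add: sum_distrib_left case_prod_unfold)
      finally show ?thesis .
    qed
  qed
  ultimately show ?thesis unfolding coisotropic_action_def by blast
qed

end
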